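(* Let $(X,d)$ be a bounded quasi-metric space whose $d$-balls are open sets, with $X=X_1\cup X_2\cup\{x_0\}$, where $X_1$, $X_2$, $\{x_0\}$ are pairwise disjoint, and suppose that $X$ satisfies property $\mathcal{C}_0$. For $i=1,2$ let $\mu_i$ be a Borel measure on $(X_i,d)$ such that $(X_i,d,\mu_i)$ is an Ahlfors $n_i$-regular space, with $0<n_1\le n_2<\infty$. Let $\gamma_1>-n_1$ and $\gamma_2>-n_2$ with $\gamma_1-\gamma_2=n_2-n_1$ and $\gamma_i>0$ for $i=1,2$, and let $\mu^{\gamma_1,\gamma_2}$ be the measure on $X$ defined by $$\mu^{\gamma_1,\gamma_2}(E)=\int_{E\cap X_1}d(x,x_0)^{\gamma_1}\,d\mu_1(x)+\int_{E\cap X_2}d(x,x_0)^{\gamma_2}\,d\mu_2(x),$$ which satisfies, for some constant $K_4$, $\mu^{\gamma_1,\gamma_2}(B(x,r))\le K_4r^{n(x)}$ for all $x\in X$ and $r>0$, where $n(x)=n_i$ if $x\in X_i$ ($i=1,2$) and $n(x_0)=n_1$. Let $0<\alpha<n_1$, $1<p<\infty$, and let $q:X\to(1,\infty)$ satisfy $1<p<q_-\le q(x)\le q_+<\infty$ for all $x\in X$, where $q_-=\inf_Xq$, $q_+=\sup_Xq$. If $$\frac1{q(x)}=\frac1p-\frac{\alpha}{n(x)}\qquad\text{for all }x\in X,$$ then the operator $$I_\alpha^{n(\cdot)}f(x)=\int_X\frac{d(x,y)^{\alpha}}{d(x,y)^{n(x)}}\,f(y)\,d\mu^{\gamma_1,\gamma_2}(y)$$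 is bounded from $L^p(X,d,\mu^{\gamma_1,\gamma_2})$ to $L^{q(\cdot)}(X,d,\mu^{\gamma_1,\gamma_2})$; that is, there is a constant $C$ with $\|I_\alpha^{n(\cdot)}f\|_{q(\cdot)}\le C\|f\|_p$ for all $f\in L^p(X,d,\mu^{\gamma_1,\gamma_2})$.
   Context: Quasi-metric: a function $d:X\times X\to[0,\infty)$ with $d(x,y)=0$ iff $x=y$, $d(x,y)=d(y,x)$, and $d(x,y)\le K_1(d(x,z)+d(z,y))$ for all $x,y,z\in X$ and some finite constant $K_1>0$. Balls: $B(x,r)=\{y\in X: d(y,x)<r\}$. Bounded means $\operatorname{diam}(X)<\infty$. Property $\mathcal{C}_0$ (contact of order zero at $x_0$): $\{x_0\}=\overline{X}_1\cap\overline{X}_2$ and there is a constant $c$ such that $d(x,x_0)\le c\,[d(x,X_1)+d(x,X_2)]$ for every $x\in X$, where $d(x,X_i)$ is the distance from $x$ to the set $X_i$. $(Y,d,\nu)$ is Ahlfors $Q$-regular, $Q>0$, if there is $A_1\ge1$ such that $A_1^{-1}r^Q\le\nu(B(y,r))\le A_1r^Q$ for all $y\in Y$ and $0<r\le\operatorname{diam}(Y)$ (balls taken in $Y$). Variable Lebesgue space over a measure $\mu$: for $\mu$-measurable $q:X\to[1,\infty)$ with $1<q_-\le q(x)\le q_+<\infty$, $L^{q(\cdot)}(X,d,\mu)$ is the space of $\mu$-measurable $f$ with $I_{q(\cdot)}(f)=\int_X|f(x)|^{q(x)}\,d\mu(x)<\infty$, normed by $\|f\|_{q(\cdot)}=\inf\{t>0: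 I_{q(\cdot)}(f/t)\le1\}$. *)

theory Defs
  imports "HOL-Analysis.Analysis"
begin

definition quasi_metric_on :: "'a set \<Rightarrow> ('a \<Rightarrow> 'a \<Rightarrow> real) \<Rightarrow> bool" where
  "quasi_metric_on X d \<longleftrightarrow>
     (\<forall>x\<in>X. \<forall>y\<in>X. 0 \<le> d x y \<and> (d x y = 0 \<longleftrightarrow> x = y) \<and> d x y = d y x) \<and>
     (\<exists>K>0. \<forall>x\<in>X. \<forall>y\<in>X. \<forall>z\<in>X. d x y \<le> K * (d x z + d z y))"

definition qball :: "'a set \<Rightarrow> ('a \<Rightarrow> 'a \<Rightarrow> real) \<Rightarrow> 'a \<Rightarrow> real \<Rightarrow> 'a set" where
  "qball X d x r = {y \<in> X. d y x < r}"

definition qdiam :: "'a set \<Rightarrow> ('a \<Rightarrow> 'a \<Rightarrow> real) \<Rightarrow> ennreal" where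
  "qdiam X d = (SUP x\<in>X. SUP y\<in>X. ennreal (d x y))"

definition qdist_set :: "('a \<Rightarrow> 'a \<Rightarrow> real) \<Rightarrow> 'a \<Rightarrow> 'a set \<Rightarrow> real" where
  "qdist_set d x A = (INF y\<in>A. d x y)"

text \<open>The topology induced by a quasi-metric. Balls need not be open in it.\<close>

definition qtopology :: "'a set \<Rightarrow> ('a \<Rightarrow> 'a \<Rightarrow> real) \<Rightarrow> 'a topology" where
  "qtopology X d = topology (\<lambda>U. U \<subseteq> X \<and> (\<forall>x\<in>U. \<exists>r>0. qball X d x r \<subseteq> U))"

lemma openin_qtopology:
  "openin (qtopology X d) U \<longleftrightarrow> U \<subseteq> X \<and> (\<forall>x\<in>U. \<exists>r>0. qball X d x r \<subseteq> U)"
proof -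
  have "istopology (\<lambda>U. U \<subseteq> X \<and> (\<forall>x\<in>U. \<exists>r>0. qball X d x r \<subseteq> U))"
    unfolding istopology_def
  proof (intro conjI allI impI ballI)
    fix S T x
    assume S: "S \<subseteq> X \<and> (\<forall>x\<in>S. \<exists>r>0. qball X d x r \<subseteq> S)"
      and T: "T \<subseteq> X \<and> (\<forall>x\<in>T. \<exists>r>0. qball X d x r \<subseteq> T)" and x: "x \<in> S \<inter> T"
    obtain r s where "r > 0" "qball X d x r \<subseteq> S" "s > 0" "qball X d x s \<subseteq> T"
      using S T x by blast
    then show "\<exists>r>0. qball X d x r \<subseteq> S \<inter> T"
      by (intro exI[of _ "min r s"]) (auto simp: qball_def)
  next
    fix \<K> x
    assume K: "\<forall>S\<in>\<K>. S \<subseteq> X \<and> (\<forall>x\<in>S. \<exists>r>0. qball X d x r \<subseteq> S)" and x: "x \<in> \<Union>\<K>"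
    then obtain S where "S \<in> \<K>" "x \<in> S" by blast
    with K obtain r where "r > 0" "qball X d x r \<subseteq> S" by blast
    with \<open>S \<in> \<K>\<close> show "\<exists>r>0. qball X d x r \<subseteq> \<Union>\<K>" by blast
  qed auto
  then show ?thesis
    by (simp add: qtopology_def topology_inverse')
qed

lemma topspace_qtopology: "topspace (qtopology X d) = X"
proof (rule antisym)
  show "topspace (qtopology X d) \<subseteq> X"
    by (rule conjunct1[OF iffD1[OF openin_qtopology openin_topspace]])
  have "openin (qtopology X d) X"
    unfolding openin_qtopology by (auto simp: qball_def intro: exI[of _ 1])
  then show "X \<subseteq> topspace (qtopology X d)"
    by (rule openin_subset)
qed

definition balls_open :: "'a set \<Rightarrow> ('a \<Rightarrow> 'a \<Rightarrow> real) \<Rightarrow> bool" where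
  "balls_open X d \<longleftrightarrow> (\<forall>x\<in>X. \<forall>r>0. openin (qtopology X d) (qball X d x r))"

definition qborel :: "'a set \<Rightarrow> ('a \<Rightarrow> 'a \<Rightarrow> real) \<Rightarrow> 'a measure" where
  "qborel X d = sigma X {U. openin (qtopology X d) U}"

lemma space_qborel [simp]: "space (qborel X d) = X"
  and sets_qborel: "sets (qborel X d) = sigma_sets X {U. openin (qtopology X d) U}"
  by (auto simp: qborel_def openin_qtopology space_measure_of_conv intro!: sets_measure_of)

definition contact_order_zero ::
    "'a set \<Rightarrow> ('a \<Rightarrow> 'a \<Rightarrow> real) \<Rightarrow> 'a set \<Rightarrow> 'a set \<Rightarrow> 'a \<Rightarrow> bool" where
  "contact_order_zero X d X1 X2 x0 \<longleftrightarrow>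
     {x0} = (qtopology X d closure_of X1) \<inter> (qtopology X d closure_of X2) \<and>
     (\<exists>c. \<forall>x\<in>X. d x x0 \<le> c * (qdist_set d x X1 + qdist_set d x X2))"

definition ahlfors_regular :: "'a set \<Rightarrow> ('a \<Rightarrow> 'a \<Rightarrow> real) \<Rightarrow> 'a measure \<Rightarrow> real \<Rightarrow> bool" where
  "ahlfors_regular Y d \<nu> Q \<longleftrightarrow> 0 < Q \<and>
     (\<exists>A\<ge>1. \<forall>y\<in>Y. \<forall>r>0. ennreal r \<le> qdiam Y d \<longrightarrow>
        ennreal (inverse A * r powr Q) \<le> emeasure \<nu> (qball Y d y r) \<and>
        emeasure \<nu> (qball Y d y r) \<le> ennreal (A * r powr Q))"

definition glued_measure ::
    "'a set \<Rightarrow> ('a \<Rightarrow> 'a \<Rightarrow> real) \<Rightarrow> 'a \<Rightarrow> 'a set \<Rightarrow> 'a measure \<Rightarrow> real \<Rightarrow>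
     'a set \<Rightarrow> 'a measure \<Rightarrow> real \<Rightarrow> 'a measure" where
  "glued_measure X d x0 X1 \<mu>1 \<gamma>1 X2 \<mu>2 \<gamma>2 =
     measure_of X {U. openin (qtopology X d) U}
       (\<lambda>E. (\<integral>\<^sup>+x\<in>E \<inter> X1. ennreal (d x x0 powr \<gamma>1) \<partial>\<mu>1) +
             (\<integral>\<^sup>+x\<in>E \<inter> X2. ennreal (d x x0 powr \<gamma>2) \<partial>\<mu>2))"

definition modular :: "'a measure \<Rightarrow> ('a \<Rightarrow> real) \<Rightarrow> ('a \<Rightarrow> real) \<Rightarrow> ennreal" where
  "modular M q f = (\<integral>\<^sup>+x. ennreal (\<bar>f x\<bar> powr q x) \<partial>M)"

definition var_Lebesgue :: "'a measure \<Rightarrow> ('a \<Rightarrow> real) \<Rightarrow> ('a \<Rightarrow> real) set" where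
  "var_Lebesgue M q = {f \<in> borel_measurable M. modular M q f < \<infinity>}"

definition var_norm :: "'a measure \<Rightarrow> ('a \<Rightarrow> real) \<Rightarrow> ('a \<Rightarrow> real) \<Rightarrow> real" where
  "var_norm M q f = Inf {t. 0 < t \<and> modular M q (\<lambda>x. f x / t) \<le> 1}"

definition Lp_space :: "'a measure \<Rightarrow> real \<Rightarrow> ('a \<Rightarrow> real) set" where
  "Lp_space M p = {f \<in> borel_measurable M. (\<integral>\<^sup>+x. ennreal (\<bar>f x\<bar> powr p) \<partial>M) < \<infinity>}"

definition Lp_norm :: "'a measure \<Rightarrow> real \<Rightarrow> ('a \<Rightarrow> real) \<Rightarrow> real" where
  "Lp_norm M p f = (\<integral>x. \<bar>f x\<bar> powr p \<partial>M) powr (1 / p)"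

text \<open>On the diagonal the kernel takes the value 0 instead of \<open>\<infinity>\<close>. This does not matter for a
  measure with \<open>\<mu>(B(x,r)) \<le> K r\<^sup>n\<^sup>(\<^sup>x\<^sup>)\<close>, for which points are null sets.\<close>

definition frac_kernel :: "('a \<Rightarrow> 'a \<Rightarrow> real) \<Rightarrow> real \<Rightarrow> ('a \<Rightarrow> real) \<Rightarrow> 'a \<Rightarrow> 'a \<Rightarrow> real" where
  "frac_kernel d \<alpha> n x y = d x y powr \<alpha> / d x y powr n x"

definition frac_integral ::
    "'a measure \<Rightarrow> ('a \<Rightarrow> 'a \<Rightarrow> real) \<Rightarrow> real \<Rightarrow> ('a \<Rightarrow> real) \<Rightarrow> ('a \<Rightarrow> real) \<Rightarrow> 'a \<Rightarrow> real" where
  "frac_integral M d \<alpha> n f x = (\<integral>y. frac_kernel d \<alpha> n x y * f y \<partial>M)"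

text \<open>\<^const>\<open>measure_of\<close> yields the zero measure if the given set function is not a measure. The
  next lemmas show that this does not happen for \<^const>\<open>glued_measure\<close>.\<close>

lemma sets_glued_measure:
  "sets (glued_measure X d x0 X1 \<mu>1 \<gamma>1 X2 \<mu>2 \<gamma>2) = sets (qborel X d)"
  unfolding glued_measure_def sets_qborel
  by (rule sets_measure_of) (auto simp: openin_qtopology)

lemma Int_sets_qborel:
  assumes "Y \<subseteq> X" "E \<in> sets (qborel X d)"
  shows "E \<inter> Y \<in> sets (qborel Y d)"
proof -
  have "(\<lambda>x. x) \<in> measurable (qborel Y d) (qborel X d)"
    unfolding qborel_def[of X]
  proof (rule measurable_measure_of)
    fix U assume "U \<in> {U. openin (qtopology X d) U}"
    then have U: "U \<subseteq> X" "\<forall>x\<in>U. \<exists>r>0. qball X d x r \<subseteq> U"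
      by (auto simp: openin_qtopology)
    have "openin (qtopology Y d) (U \<inter> Y)"
      unfolding openin_qtopology
    proof (intro conjI ballI)
      fix x assume "x \<in> U \<inter> Y"
      then obtain r where "r > 0" "qball X d x r \<subseteq> U" using U by blast
      then show "\<exists>r>0. qball Y d x r \<subseteq> U \<inter> Y"
        using assms(1) by (intro exI[of _ r]) (auto simp: qball_def)
    qed auto
    then show "(\<lambda>x. x) -` U \<inter> space (qborel Y d) \<in> sets (qborel Y d)"
      by (auto simp: sets_qborel)
  qed (use assms(1) in \<open>auto simp: openin_qtopology\<close>)
  from measurable_sets[OF this assms(2)] show ?thesis by simp
qed

lemma borel_measurable_quasi_metric:
  assumes "balls_open X d" "x0 \<in> X" "Y \<subseteq> X"
    and nonneg: "\<And>x. x \<in> X \<Longrightarrow> 0 \<le> d x x0"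
  shows "(\<lambda>x. d x x0) \<in> borel_measurable (qborel Y d)"
proof (rule borel_measurableI_less)
  fix r
  have "qball X d x0 r \<in> sets (qborel X d)"
  proof (cases "r > 0")
    case True
    then show ?thesis using assms(1,2) by (auto simp: balls_open_def sets_qborel)
  next
    case False
    then have "qball X d x0 r = {}" using nonneg by (fastforce simp: qball_def)
    then show ?thesis by simp
  qed
  then have "qball X d x0 r \<inter> Y \<in> sets (qborel Y d)"
    using assms(3) by (rule Int_sets_qborel[rotated])
  moreover have "qball X d x0 r \<inter> Y = {x \<in> space (qborel Y d). d x x0 < r}"
    using assms(3) by (auto simp: qball_def)
  ultimately show "{x \<in> space (qborel Y d). d x x0 < r} \<in> sets (qborel Y d)" by simp
qed

lemma emeasure_glued_measure:
  assumes "quasi_metric_on X d" "balls_open X d" "x0 \<in> X" "X1 \<subseteq> X" "X2 \<subseteq> X"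
    and sets: "sets \<mu>1 = sets (qborel X1 d)" "sets \<mu>2 = sets (qborel X2 d)"
    and E: "E \<in> sets (qborel X d)"
  shows "emeasure (glued_measure X d x0 X1 \<mu>1 \<gamma>1 X2 \<mu>2 \<gamma>2) E =
     (\<integral>\<^sup>+x\<in>E \<inter> X1. ennreal (d x x0 powr \<gamma>1) \<partial>\<mu>1) +
     (\<integral>\<^sup>+x\<in>E \<inter> X2. ennreal (d x x0 powr \<gamma>2) \<partial>\<mu>2)"
proof -
  have part: "countably_additive (sets (qborel X d))
      (\<lambda>E. \<integral>\<^sup>+x\<in>E \<inter> Y. ennreal (d x x0 powr \<gamma>) \<partial>\<nu>)"
    if Y: "Y \<subseteq> X" and \<nu>: "sets \<nu> = sets (qborel Y d)" for Y \<gamma> and \<nu> :: "'a measure"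
  proof (rule countably_additiveI)
    fix A :: "nat \<Rightarrow> 'a set"
    assume A: "range A \<subseteq> sets (qborel X d)" "disjoint_family A"
    have [measurable]: "(\<lambda>x. d x x0) \<in> borel_measurable \<nu>"
      unfolding measurable_cong_sets[OF \<nu> refl]
      by (rule borel_measurable_quasi_metric[OF assms(2,3) Y])
        (use assms(1,3) in \<open>auto simp: quasi_metric_on_def\<close>)
    have B: "range (\<lambda>i. A i \<inter> Y) \<subseteq> sets \<nu>"
      using A(1) unfolding \<nu> by (blast intro: Int_sets_qborel[OF Y])
    have eq: "(\<integral>\<^sup>+x\<in>B. ennreal (d x x0 powr \<gamma>) \<partial>\<nu>) =
        emeasure (density \<nu> (\<lambda>x. ennreal (d x x0 powr \<gamma>))) B" if "B \<in> sets \<nu>" for B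
      using that by (subst emeasure_density) auto
    have "(\<Sum>i. \<integral>\<^sup>+x\<in>A i \<inter> Y. ennreal (d x x0 powr \<gamma>) \<partial>\<nu>) =
        (\<Sum>i. emeasure (density \<nu> (\<lambda>x. ennreal (d x x0 powr \<gamma>))) (A i \<inter> Y))"
      by (intro suminf_cong eq) (use B in blast)
    also have "\<dots> = emeasure (density \<nu> (\<lambda>x. ennreal (d x x0 powr \<gamma>))) (\<Union>i. A i \<inter> Y)"
      using B A(2) by (intro suminf_emeasure) (auto simp: disjoint_family_on_def)
    also have "\<dots> = (\<integral>\<^sup>+x\<in>(\<Union>i. A i \<inter> Y). ennreal (d x x0 powr \<gamma>) \<partial>\<nu>)"
      by (rule eq[symmetric]) (use B in blast)
    also have "(\<Union>i. A i \<inter> Y) = \<Union> (range A) \<inter> Y" by blast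
    finally show "(\<Sum>i. \<integral>\<^sup>+x\<in>A i \<inter> Y. ennreal (d x x0 powr \<gamma>) \<partial>\<nu>) =
        (\<integral>\<^sup>+x\<in>\<Union> (range A) \<inter> Y. ennreal (d x x0 powr \<gamma>) \<partial>\<nu>)" .
  qed
  show ?thesis
  proof (rule emeasure_measure_of[OF glued_measure_def])
    show "{U. openin (qtopology X d) U} \<subseteq> Pow X" by (auto simp: openin_qtopology)
    show "E \<in> sets (glued_measure X d x0 X1 \<mu>1 \<gamma>1 X2 \<mu>2 \<gamma>2)"
      using E by (simp add: sets_glued_measure)
    show "countably_additive (sets (glued_measure X d x0 X1 \<mu>1 \<gamma>1 X2 \<mu>2 \<gamma>2))
        (\<lambda>E. (\<integral>\<^sup>+x\<in>E \<inter> X1. ennreal (d x x0 powr \<gamma>1) \<partial>\<mu>1) +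
              (\<integral>\<^sup>+x\<in>E \<inter> X2. ennreal (d x x0 powr \<gamma>2) \<partial>\<mu>2))"
      unfolding sets_glued_measure
    proof (rule countably_additiveI)
      fix A :: "nat \<Rightarrow> 'a set"
      assume A: "range A \<subseteq> sets (qborel X d)" "disjoint_family A" "\<Union> (range A) \<in> sets (qborel X d)"
      show "(\<Sum>i. (\<integral>\<^sup>+x\<in>A i \<inter> X1. ennreal (d x x0 powr \<gamma>1) \<partial>\<mu>1) +
              (\<integral>\<^sup>+x\<in>A i \<inter> X2. ennreal (d x x0 powr \<gamma>2) \<partial>\<mu>2)) =
          (\<integral>\<^sup>+x\<in>\<Union> (range A) \<inter> X1. ennreal (d x x0 powr \<gamma>1) \<partial>\<mu>1) +
          (\<integral>\<^sup>+x\<in>\<Union> (range A) \<inter> X2. ennreal (d x x0 powr \<gamma>2) \<partial>\<mu>2)"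
        using part[OF assms(4) sets(1), of \<gamma>1] part[OF assms(5) sets(2), of \<gamma>2] A
        by (subst suminf_add[symmetric]) (auto simp: countably_additive_def)
    qed
  qed (simp add: positive_def)
qed

end

theory Submission
  imports Defs
begin

text \<open>
  The dimension \<open>n(x)\<close> takes the value \<open>n1\<close> on \<open>X1 \<union> {x0}\<close> and \<open>n2\<close> on \<open>X2\<close>, and both sets are Borel
  because \<open>x0\<close> is the only common point of the closures of \<open>X1\<close> and \<open>X2\<close>. The exponent \<open>q\<close> is
  therefore constant on each of the two pieces, and the theorem splits into two inequalities of
  Hardy-Littlewood-Sobolev type: on a piece \<open>Y\<close> with dimension \<open>n\<close> the potential
  \<open>T g (x) = \<integral> d(x,y)^(\<alpha> - n) g(y) d\<mu>(y)\<close> maps \<open>L^p(X)\<close> to \<open>L^q(Y)\<close>, where \<open>1/q = 1/p - \<alpha>/n\<close>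
  (\<open>potential_strong_type\<close>). The inequality rests on the upper bound \<open>\<mu>(B(x,r)) \<le> A r^n\<close> for
  \<open>x \<in> Y\<close>. This bound is its own dual: if \<open>B(y,r)\<close> meets \<open>Y\<close>, it lies in a comparable ball centred in
  \<open>Y\<close>, so that \<open>\<mu>(Y \<inter> B(y,r)) \<le> A' r^n\<close> for every \<open>y \<in> X\<close> (\<open>dual_growth\<close>).

  For the strong type estimate let \<open>g \<ge> 0\<close> with \<open>\<integral> g^p \<le> 1\<close>, fix a level \<open>t > 0\<close> and put
  \<open>r = t^(-q/n)\<close> and \<open>s = t^(q/p)\<close>. The integral over \<open>d(x,y) \<ge> r\<close> is \<open>O(t)\<close> by Young's inequality, and
  the part of \<open>g\<close> below the height \<open>s\<close> contributes \<open>O(s r^\<alpha>) = O(t)\<close> over \<open>d(x,y) < r\<close>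
  (\<open>potential_split_le\<close>). Hence \<open>T g(x) > c t\<close> forces the near potential of \<open>g 1_{g > s}\<close> to be at
  least \<open>t\<close>, and the \<open>L^1(Y)\<close> norm of that near potential is \<open>O(r^\<alpha> \<integral>_{g > s} g)\<close> by the dual growth
  bound (\<open>dyadic_potential_L1\<close>). Chebyshev's inequality and the layer cake formula leave the integral
  \<open>\<integral> g(y) \<integral>_{0 < t < g(y)^(p/q)} t^(q - q/p - 1) dt d\<mu>(y)\<close>, which is a multiple of \<open>\<integral> g^p\<close>.

  Measurability needs care. Since balls are open, \<open>d\<close> is upper semicontinuous in each variable
  separately, but it need not be jointly measurable. Two devices replace Tonelli's theorem on
  \<open>X \<times> X\<close>. The kernel is lower semicontinuous in \<open>x\<close>, and by Fatou's lemma so are all potentials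
  (\<open>lsc_nn_integral\<close>). The exchange of the order of integration is carried out on a countable net
  (\<open>ball_measure_swap\<close>); such nets exist because \<open>\<mu>\<close> is finite and, by the lower Ahlfors bounds, gives
  positive measure to every ball (\<open>countable_net\<close>, \<open>ahlfors_weighted_ball_pos\<close>).
\<close>

section \<open>Semicontinuity and measurability\<close>

locale quasi_metric_measure =
  fixes X :: "'a set" and d :: "'a \<Rightarrow> 'a \<Rightarrow> real" and K :: real and M :: "'a measure"
  assumes K_pos: "0 < K"
    and nonneg: "x \<in> X \<Longrightarrow> y \<in> X \<Longrightarrow> 0 \<le> d x y"
    and zero_iff: "x \<in> X \<Longrightarrow> y \<in> X \<Longrightarrow> d x y = 0 \<longleftrightarrow> x = y"
    and sym: "x \<in> X \<Longrightarrow> y \<in> X \<Longrightarrow> d x y = d y x"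
    and tri: "x \<in> X \<Longrightarrow> y \<in> X \<Longrightarrow> z \<in> X \<Longrightarrow> d x y \<le> K * (d x z + d z y)"
    and balls: "balls_open X d"
    and sets_M: "sets M = sets (qborel X d)"
    and finite_M: "emeasure M X < \<infinity>"
begin

lemma space_M [simp]: "space M = X"
  using sets_eq_imp_space_eq[OF sets_M] by simp

sublocale finite_measure M
  by standard (use finite_M in auto)

lemma open_measurable: "openin (qtopology X d) U \<Longrightarrow> U \<in> sets M"
  by (auto simp: sets_M sets_qborel)

lemma ball_open: "x \<in> X \<Longrightarrow> openin (qtopology X d) (qball X d x r)"
proof (cases "r > 0")
  case False
  assume "x \<in> X"
  with False nonneg have "qball X d x r = {}" by (fastforce simp: qball_def)
  then show ?thesis by simp
qed (use balls in \<open>auto simp: balls_open_def\<close>)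

lemma ball_measurable [measurable]: "x \<in> X \<Longrightarrow> qball X d x r \<in> sets M"
  using ball_open open_measurable by blast

lemma mem_ball: "x \<in> X \<Longrightarrow> y \<in> qball X d x r \<longleftrightarrow> y \<in> X \<and> d x y < r"
  by (auto simp: qball_def sym)

lemma ball_subset_ball:
  assumes "x \<in> X" "z \<in> X" "d x z < r"
  shows "qball X d x s \<subseteq> qball X d z (K * (r + s))"
proof
  fix y assume "y \<in> qball X d x s"
  then have y: "y \<in> X" "d x y < s" using assms by (auto simp: mem_ball)
  have "d z y \<le> K * (d z x + d x y)" using tri assms y by blast
  also have "\<dots> < K * (r + s)"
    using y assms sym K_pos by (intro mult_strict_left_mono) auto
  finally show "y \<in> qball X d z (K * (r + s))" using y assms by (simp add: mem_ball)
qed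

lemma dist_measurable [measurable]:
  assumes "x \<in> X"
  shows "(\<lambda>y. d x y) \<in> borel_measurable M"
proof -
  have "(\<lambda>y. d y x) \<in> borel_measurable M"
    unfolding measurable_cong_sets[OF sets_M refl]
    by (rule borel_measurable_quasi_metric[OF balls]) (use assms nonneg in auto)
  then show ?thesis
    by (rule measurable_cong[THEN iffD1, rotated]) (use assms sym in auto)
qed

lemma punctured_ball_open:
  assumes "x \<in> X" "y \<in> X"
  shows "openin (qtopology X d) (qball X d x r - {y})"
  unfolding openin_qtopology
proof (intro conjI ballI)
  fix z assume z: "z \<in> qball X d x r - {y}"
  then have zX: "z \<in> X" "d z y > 0"
    using zero_iff[of z y] nonneg[of z y] assms by (auto simp: qball_def)
  obtain s where s: "s > 0" "qball X d z s \<subseteq> qball X d x r"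
    using z ball_open[OF assms(1)] unfolding openin_qtopology by blast
  have "y \<notin> qball X d z (d z y)" using assms zX by (simp add: mem_ball)
  then show "\<exists>s>0. qball X d z s \<subseteq> qball X d x r - {y}"
    using s zX by (intro exI[of _ "min s (d z y)"]) (auto simp: qball_def)
qed (auto simp: qball_def)

definition lsc :: "('a \<Rightarrow> ennreal) \<Rightarrow> bool" where
  "lsc h \<longleftrightarrow> (\<forall>c. openin (qtopology X d) {x \<in> X. c < h x})"

lemma lsc_measurable: "lsc h \<Longrightarrow> h \<in> borel_measurable M"
  by (rule borel_measurableI_greater) (use open_measurable in \<open>auto simp: lsc_def\<close>)

text \<open>The topology is first countable, so a failure of semicontinuity at \<open>x\<close> is witnessed by a sequence
  converging to \<open>x\<close>, along which Fatou's lemma applies. In this way measurability of \<open>h x\<close> for each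
  \<open>x\<close> is enough, where Tonelli's theorem would ask for joint measurability of \<open>h\<close>.\<close>
lemma lsc_nn_integral:
  assumes h: "\<And>y. y \<in> X \<Longrightarrow> lsc (\<lambda>x. h x y)"
    and meas: "\<And>x. x \<in> X \<Longrightarrow> h x \<in> borel_measurable \<nu>" and sets: "sets \<nu> = sets M"
  shows "lsc (\<lambda>x. \<integral>\<^sup>+y. h x y \<partial>\<nu>)"
  unfolding lsc_def openin_qtopology
proof (intro allI conjI ballI)
  fix c x assume "x \<in> {x \<in> X. c < (\<integral>\<^sup>+y. h x y \<partial>\<nu>)}"
  then have x: "x \<in> X" and c: "c < (\<integral>\<^sup>+y. h x y \<partial>\<nu>)" by auto
  have sp: "space \<nu> = X" using sets_eq_imp_space_eq[OF sets] by simp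
  show "\<exists>r>0. qball X d x r \<subseteq> {x \<in> X. c < (\<integral>\<^sup>+y. h x y \<partial>\<nu>)}"
  proof (rule ccontr)
    assume "\<not> ?thesis"
    then have "\<forall>m. \<exists>z. z \<in> qball X d x (1 / real (Suc m)) \<and> (\<integral>\<^sup>+y. h z y \<partial>\<nu>) \<le> c"
      by (metis (no_types, lifting) divide_pos_pos mem_Collect_eq not_less of_nat_0_less_iff
          qball_def subsetI zero_less_Suc zero_less_one)
    then obtain z where z: "\<And>m. z m \<in> qball X d x (1 / real (Suc m))"
      "\<And>m. (\<integral>\<^sup>+y. h (z m) y \<partial>\<nu>) \<le> c" by metis
    have zX: "z m \<in> X" for m using z(1)[of m] by (auto simp: qball_def)
    have lim: "h x y \<le> liminf (\<lambda>m. h (z m) y)" if y: "y \<in> X" for y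
      unfolding le_Liminf_iff
    proof (intro allI impI)
      fix b assume "b < h x y"
      then obtain r where r: "r > 0" "qball X d x r \<subseteq> {x \<in> X. b < h x y}"
        using h[OF y] x unfolding lsc_def openin_qtopology by blast
      obtain m0 where m0: "1 / real (Suc m0) < r" using r(1) nat_approx_posE by blast
      have "b < h (z m) y" if "m \<ge> m0" for m
      proof -
        have "1 / real (Suc m) \<le> 1 / real (Suc m0)" using that by (simp add: frac_le)
        with z(1)[of m] m0 have "z m \<in> qball X d x r" by (auto simp: qball_def)
        with r show ?thesis by auto
      qed
      then show "\<forall>\<^sub>F m in sequentially. b < h (z m) y"
        by (auto simp: eventually_sequentially)
    qed
    have "(\<integral>\<^sup>+y. h x y \<partial>\<nu>) \<le> (\<integral>\<^sup>+y. liminf (\<lambda>m. h (z m) y) \<partial>\<nu>)"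
      by (rule nn_integral_mono) (use lim sp in auto)
    also have "\<dots> \<le> liminf (\<lambda>m. \<integral>\<^sup>+y. h (z m) y \<partial>\<nu>)"
      by (rule nn_integral_liminf) (use zX meas in auto)
    also have "\<dots> \<le> liminf (\<lambda>m::nat. c)"
      by (rule Liminf_mono) (use z(2) in auto)
    also have "\<dots> = c" by (simp add: Liminf_const)
    finally show False using c by simp
  qed
qed auto

lemma lsc_ball_measure:
  assumes sets: "sets \<nu> = sets M"
  shows "lsc (\<lambda>x. emeasure \<nu> (qball X d x r))"
proof -
  have "lsc (\<lambda>x. \<integral>\<^sup>+y. indicator (qball X d x r) y \<partial>\<nu>)"
  proof (rule lsc_nn_integral[OF _ _ sets])
    fix y assume y: "y \<in> X"
    have "{x \<in> X. c < (indicator (qball X d x r) y :: ennreal)} =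
        (if c < 1 then qball X d y r else {})" for c
      using y by (auto simp: indicator_def qball_def sym)
    then show "lsc (\<lambda>x. indicator (qball X d x r) y)"
      using ball_open[OF y] by (auto simp: lsc_def)
  next
    fix x assume "x \<in> X"
    then show "indicator (qball X d x r) \<in> borel_measurable \<nu>"
      using sets by (intro borel_measurable_indicator) auto
  qed
  moreover have "(\<integral>\<^sup>+y. indicator (qball X d x r) y \<partial>\<nu>) = emeasure \<nu> (qball X d x r)"
    if "x \<in> X" for x using that by (simp add: ball_measurable sets)
  ultimately show ?thesis by (simp add: lsc_def cong: conj_cong)
qed

text \<open>Away from the diagonal this reflects the upper semicontinuity of \<open>d\<close>, that is, openness of balls. On
  the diagonal the kernel has the smallest value \<open>0\<close> (from \<open>0 powr - \<beta> = 0\<close>), which is harmless for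
  lower semicontinuity at \<open>y\<close>; at other points it forces the balls around \<open>y\<close> to be punctured.\<close>
lemma lsc_power_kernel:
  assumes "y \<in> X" "0 < \<beta>"
  shows "lsc (\<lambda>x. ennreal (d x y powr - \<beta>))"
  unfolding lsc_def openin_qtopology
proof (intro allI conjI ballI)
  fix c x assume "x \<in> {x \<in> X. c < ennreal (d x y powr - \<beta>)}"
  then have x: "x \<in> X" and c: "c < ennreal (d x y powr - \<beta>)" by auto
  obtain b where b: "c = ennreal b" "0 \<le> b" "b < d x y powr - \<beta>"
    using c by (cases c) (auto simp: ennreal_less_iff)
  have pos: "0 < d x y" using b nonneg[OF x assms(1)] by (cases "d x y = 0") auto
  have "isCont (\<lambda>t. t powr - \<beta>) (d x y)" using pos by (intro continuous_intros) auto
  then have "\<forall>\<^sub>F t in at (d x y). b < t powr - \<beta>"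
    using b(3) unfolding isCont_def by (rule order_tendstoD(1))
  then obtain \<epsilon> where \<epsilon>: "\<epsilon> > 0"
      "\<And>t. t \<noteq> d x y \<Longrightarrow> dist t (d x y) < \<epsilon> \<Longrightarrow> b < t powr - \<beta>"
    unfolding eventually_at by auto
  define t where "t = d x y + \<epsilon> / 2"
  have t: "d x y < t" "b < t powr - \<beta>" "0 < t"
    using \<epsilon> pos by (auto simp: t_def dist_real_def)
  have "openin (qtopology X d) (qball X d y t - {y})"
    by (rule punctured_ball_open) (use assms t in auto)
  moreover have "x \<in> qball X d y t - {y}"
    using x pos t zero_iff[OF assms(1) assms(1)] by (auto simp: qball_def)
  ultimately obtain r where r: "r > 0" "qball X d x r \<subseteq> qball X d y t - {y}"
    unfolding openin_qtopology by blast
  have "c < ennreal (d z y powr - \<beta>)" if "z \<in> qball X d x r" for z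
  proof -
    have z: "z \<in> X" "z \<noteq> y" "d z y < t" using that r by (auto simp: qball_def)
    then have "0 < d z y" using zero_iff[of z y] nonneg[of z y] assms(1) by auto
    then have "t powr - \<beta> \<le> d z y powr - \<beta>"
      using z assms(2) by (intro powr_mono2') auto
    then show ?thesis using t(2) b by (auto simp: ennreal_less_iff)
  qed
  then show "\<exists>r>0. qball X d x r \<subseteq> {x \<in> X. c < ennreal (d x y powr - \<beta>)}"
    using r by (auto simp: qball_def)
qed auto

lemma potential_measurable:
  assumes "0 < \<beta>" and g: "g \<in> borel_measurable M"
  shows "(\<lambda>x. \<integral>\<^sup>+y. ennreal (d x y powr - \<beta>) * g y \<partial>M) \<in> borel_measurable M"
proof -
  have "(\<lambda>x. \<integral>\<^sup>+y. ennreal (d x y powr - \<beta>) \<partial>density M g) \<in> borel_measurable M"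
    using lsc_power_kernel[OF _ assms(1)]
    by (intro lsc_measurable lsc_nn_integral) auto
  also have "?this \<longleftrightarrow> ?thesis"
    using g by (intro measurable_cong) (subst nn_integral_density, auto simp: mult.commute)
  finally show ?thesis .
qed

text \<open>The Bochner integral is \<open>0\<close> where it does not converge absolutely, so it is a difference of two
  potentials restricted to the measurable set on which the potential of \<open>\<bar>f\<bar>\<close> is finite.\<close>
lemma frac_integral_measurable:
  assumes "0 < \<beta>" and f [measurable]: "f \<in> borel_measurable M"
  shows "(\<lambda>x. \<integral>y. d x y powr - \<beta> * f y \<partial>M) \<in> borel_measurable M"
proof -
  define U where "U g x = (\<integral>\<^sup>+y. ennreal (d x y powr - \<beta>) * ennreal (g y) \<partial>M)" for g x
  have [measurable]: "U (\<lambda>y. \<bar>f y\<bar>) \<in> borel_measurable M" "U f \<in> borel_measurable M"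
    "U (\<lambda>y. - f y) \<in> borel_measurable M"
    unfolding U_def by (rule potential_measurable; use assms in simp)+
  have "(\<integral>y. d x y powr - \<beta> * f y \<partial>M) =
      (if U (\<lambda>y. \<bar>f y\<bar>) x < \<infinity> then enn2real (U f x) - enn2real (U (\<lambda>y. - f y) x) else 0)"
    if x: "x \<in> X" for x
  proof (cases "integrable M (\<lambda>y. d x y powr - \<beta> * f y)")
    case True
    then have "U (\<lambda>y. \<bar>f y\<bar>) x < \<infinity>"
      by (simp add: integrable_iff_bounded U_def abs_mult ennreal_mult)
    then show ?thesis
      unfolding real_lebesgue_integral_def[OF True] mult_minus_right[symmetric] U_def
      by (simp del: mult_minus_right flip: ennreal_mult')
  next
    case False
    have "(\<lambda>y. d x y powr - \<beta> * f y) \<in> borel_measurable M" using x by measurable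
    with False have "\<not> U (\<lambda>y. \<bar>f y\<bar>) x < \<infinity>"
      by (simp add: integrable_iff_bounded U_def abs_mult ennreal_mult)
    with False show ?thesis by (simp add: not_integrable_integral_eq)
  qed
  then show ?thesis
    by (subst measurable_cong) (auto simp del: infinity_ennreal_def)
qed

end

section \<open>Decomposition of the kernel into dyadic scales\<close>

lemma suminf_ennreal_geometric:
  assumes "0 \<le> a" "0 \<le> w" "w < 1"
  shows "(\<Sum>j. ennreal (a * w ^ j)) = ennreal (a / (1 - w))"
proof (rule suminf_ennreal_eq)
  show "(\<lambda>j. a * w ^ j) sums (a / (1 - w))"
    using sums_mult[OF geometric_sums[of w], of a] assms by simp
qed (use assms in auto)

text \<open>For \<open>\<beta> < n\<close> the small scales of \<open>d powr - \<beta>\<close> have geometrically decaying mass, with ratio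
  \<open>2 powr (\<beta> - n)\<close> from one scale to the next.\<close>
lemma near_scales_sum:
  assumes "0 \<le> A" "0 < r" "\<beta> < n"
  shows "(\<Sum>j. ennreal ((r / 2 ^ Suc j) powr - \<beta>) * ennreal (A * (r / 2 ^ j) powr n)) =
    ennreal (A * 2 powr \<beta> / (1 - 2 powr (\<beta> - n)) * r powr (n - \<beta>))"
proof -
  have "(r / 2 ^ Suc j) powr - \<beta> * (A * (r / 2 ^ j) powr n) =
      A * 2 powr \<beta> * r powr (n - \<beta>) * (2 powr (\<beta> - n)) ^ j" for j
  proof -
    have t: "r / 2 ^ j = r * 2 powr (- real j)" "r / 2 ^ Suc j = r * 2 powr (- real j) * 2 powr - 1"
      using powr_realpow[of 2 j] by (simp_all add: powr_minus_divide)
    have r: "r powr - \<beta> * r powr n = r powr (n - \<beta>)" using assms(2) by (simp flip: powr_add)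
    have s: "2 powr (- real j * - \<beta>) * 2 powr (- real j * n) = (2 powr (\<beta> - n)) ^ j"
      by (simp add: powr_power algebra_simps flip: powr_add)
    have "(r / 2 ^ Suc j) powr - \<beta> * (A * (r / 2 ^ j) powr n) =
        A * 2 powr \<beta> * (r powr - \<beta> * r powr n) *
          (2 powr (- real j * - \<beta>) * 2 powr (- real j * n))"
      unfolding t using assms(2)
      by (simp only: powr_mult powr_powr less_imp_le powr_ge_zero mult_nonneg_nonneg)
        (simp add: mult_ac)
    then show ?thesis by (simp only: r s)
  qed
  note prod = this
  have eq: "ennreal ((r / 2 ^ Suc j) powr - \<beta>) * ennreal (A * (r / 2 ^ j) powr n) =
      ennreal (A * 2 powr \<beta> * r powr (n - \<beta>) * (2 powr (\<beta> - n)) ^ j)" for j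
    unfolding prod[symmetric] by (rule ennreal_mult'[symmetric]) simp
  have "2 powr (\<beta> - n) < 1"
    using assms powr_less_mono[of "\<beta> - n" 0 2] by simp
  then show ?thesis
    unfolding eq using assms by (subst suminf_ennreal_geometric) auto
qed

lemma far_scales_sum:
  assumes "0 \<le> A" "0 < r" "n < \<beta>"
  shows "(\<Sum>j. ennreal ((2 ^ j * r) powr - \<beta>) * ennreal (A * (2 ^ Suc j * r) powr n)) =
    ennreal (A * 2 powr n / (1 - 2 powr (n - \<beta>)) * r powr (n - \<beta>))"
proof -
  have "(2 ^ j * r) powr - \<beta> * (A * (2 ^ Suc j * r) powr n) =
      A * 2 powr n * r powr (n - \<beta>) * (2 powr (n - \<beta>)) ^ j" for j
  proof -
    have t: "2 ^ j * r = r * 2 powr (real j)" "2 ^ Suc j * r = r * 2 powr (real j) * 2 powr 1"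
      by (simp_all add: powr_realpow)
    have r: "r powr - \<beta> * r powr n = r powr (n - \<beta>)" using assms(2) by (simp flip: powr_add)
    have s: "2 powr (real j * - \<beta>) * 2 powr (real j * n) = (2 powr (n - \<beta>)) ^ j"
      by (simp add: powr_power algebra_simps flip: powr_add)
    have "(2 ^ j * r) powr - \<beta> * (A * (2 ^ Suc j * r) powr n) =
        A * 2 powr n * (r powr - \<beta> * r powr n) *
          (2 powr (real j * - \<beta>) * 2 powr (real j * n))"
      unfolding t using assms(2) by (simp add: powr_mult powr_powr)
    then show ?thesis by (simp only: r s)
  qed
  note prod = this
  have eq: "ennreal ((2 ^ j * r) powr - \<beta>) * ennreal (A * (2 ^ Suc j * r) powr n) =
      ennreal (A * 2 powr n * r powr (n - \<beta>) * (2 powr (n - \<beta>)) ^ j)" for j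
    unfolding prod[symmetric] by (rule ennreal_mult'[symmetric]) simp
  have "2 powr (n - \<beta>) < 1"
    using assms powr_less_mono[of "n - \<beta>" 0 2] by simp
  then show ?thesis
    unfolding eq using assms by (subst suminf_ennreal_geometric) auto
qed

lemma le_suminf_ennreal: "f i \<le> suminf f" for f :: "nat \<Rightarrow> ennreal"
  using sum_le_suminf[OF summableI, of "{i}" f] by simp

context quasi_metric_measure
begin

text \<open>Every \<open>y\<close> with \<open>0 < d x y < r\<close> lies in a shell \<open>r / 2 ^ Suc j \<le> d x y < r / 2 ^ j\<close>, where the kernel is
  at most \<open>(r / 2 ^ Suc j) powr - \<beta>\<close>. The measure is arbitrary because the bound is used both for \<open>M\<close>
  and for measures with a density.\<close>
lemma near_kernel_integral_le:
  assumes "0 < \<beta>" "0 < r" "x \<in> X" and sets: "sets \<nu> = sets M"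
  shows "(\<integral>\<^sup>+y. ennreal (d x y powr - \<beta>) * indicator (qball X d x r) y \<partial>\<nu>) \<le>
    (\<Sum>j. ennreal ((r / 2 ^ Suc j) powr - \<beta>) * emeasure \<nu> (qball X d x (r / 2 ^ j)))"
proof -
  have sp: "space \<nu> = X" using sets_eq_imp_space_eq[OF sets] by simp
  have [measurable]: "qball X d x s \<in> sets \<nu>" for s using assms(3) sets by simp
  have "ennreal (d x y powr - \<beta>) * indicator (qball X d x r) y \<le>
      (\<Sum>j. ennreal ((r / 2 ^ Suc j) powr - \<beta>) * indicator (qball X d x (r / 2 ^ j)) y)"
    if y: "y \<in> X" for y
  proof (cases "y \<in> qball X d x r \<and> d x y \<noteq> 0")
    case True
    then have d: "0 < d x y" "d x y < r"
      using nonneg[OF assms(3) y] assms(3) by (auto simp: mem_ball)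
    obtain k where "(1 / 2) ^ k < d x y / r"
      using real_arch_pow_inv[of "d x y / r" "1 / 2"] d by auto
    then have k: "r / 2 ^ k < d x y" using assms(2) by (simp add: field_simps power_divide)
    have "r / 2 ^ Suc k \<le> d x y" using k assms(2) by (simp add: field_simps)
    then obtain j where j: "r / 2 ^ Suc j \<le> d x y"
      and least: "\<And>i. i < j \<Longrightarrow> \<not> r / 2 ^ Suc i \<le> d x y"
      using exists_least_iff[of "\<lambda>k. r / 2 ^ Suc k \<le> d x y"] by blast
    have j': "d x y < r / 2 ^ j"
    proof (cases j)
      case (Suc i)
      then show ?thesis using least[of i] by simp
    qed (use d in simp)
    have "d x y powr - \<beta> \<le> (r / 2 ^ Suc j) powr - \<beta>"
      using j assms by (intro powr_mono2') auto
    then have "ennreal (d x y powr - \<beta>) * indicator (qball X d x r) y \<le>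
        ennreal ((r / 2 ^ Suc j) powr - \<beta>) * indicator (qball X d x (r / 2 ^ j)) y"
      using True j' y assms(3) by (auto simp: mem_ball intro: ennreal_leI)
    also have "\<dots> \<le> (\<Sum>j. ennreal ((r / 2 ^ Suc j) powr - \<beta>) *
        indicator (qball X d x (r / 2 ^ j)) y)"
      by (rule le_suminf_ennreal)
    finally show ?thesis .
  qed auto
  then have "(\<integral>\<^sup>+y. ennreal (d x y powr - \<beta>) * indicator (qball X d x r) y \<partial>\<nu>) \<le>
      (\<integral>\<^sup>+y. (\<Sum>j. ennreal ((r / 2 ^ Suc j) powr - \<beta>) *
        indicator (qball X d x (r / 2 ^ j)) y) \<partial>\<nu>)"
    by (intro nn_integral_mono) (auto simp: sp)
  also have "\<dots> = (\<Sum>j. ennreal ((r / 2 ^ Suc j) powr - \<beta>) * emeasure \<nu> (qball X d x (r / 2 ^ j)))"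
    by (subst nn_integral_suminf) (auto simp: nn_integral_cmult_indicator)
  finally show ?thesis .
qed

lemma far_kernel_integral_le:
  assumes "0 < \<beta>" "0 < r" "x \<in> X"
  shows "(\<integral>\<^sup>+y. ennreal (d x y powr - \<beta>) * indicator (X - qball X d x r) y \<partial>M) \<le>
    (\<Sum>j. ennreal ((2 ^ j * r) powr - \<beta>) * emeasure M (qball X d x (2 ^ Suc j * r)))"
proof -
  have [measurable]: "qball X d x s \<in> sets M" for s using assms(3) by simp
  have "ennreal (d x y powr - \<beta>) * indicator (X - qball X d x r) y \<le>
      (\<Sum>j. ennreal ((2 ^ j * r) powr - \<beta>) * indicator (qball X d x (2 ^ Suc j * r)) y)"
    if y: "y \<in> X" for y
  proof (cases "y \<in> qball X d x r")
    case False
    then have d: "r \<le> d x y" using y assms(3) by (auto simp: mem_ball)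
    obtain k where "d x y / r < 2 ^ k"
      using real_arch_pow[of 2 "d x y / r"] by auto
    then have k: "d x y < 2 ^ k * r" using assms(2) by (simp add: field_simps)
    have "2 ^ k * r \<le> 2 ^ Suc k * r" using assms(2) by simp
    then have "d x y < 2 ^ Suc k * r" using k by (rule less_le_trans[rotated])
    then obtain j where j: "d x y < 2 ^ Suc j * r"
      and least: "\<And>i. i < j \<Longrightarrow> \<not> d x y < 2 ^ Suc i * r"
      using exists_least_iff[of "\<lambda>k. d x y < 2 ^ Suc k * r"] by blast
    have j': "2 ^ j * r \<le> d x y"
    proof (cases j)
      case (Suc i)
      then show ?thesis using least[of i] by simp
    qed (use d in simp)
    have "d x y powr - \<beta> \<le> (2 ^ j * r) powr - \<beta>"
      using j' assms by (intro powr_mono2') auto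
    then have "ennreal (d x y powr - \<beta>) * indicator (X - qball X d x r) y \<le>
        ennreal ((2 ^ j * r) powr - \<beta>) * indicator (qball X d x (2 ^ Suc j * r)) y"
      using False j y assms(3) by (auto simp: mem_ball intro: ennreal_leI)
    also have "\<dots> \<le> (\<Sum>j. ennreal ((2 ^ j * r) powr - \<beta>) *
        indicator (qball X d x (2 ^ Suc j * r)) y)"
      by (rule le_suminf_ennreal)
    finally show ?thesis .
  qed auto
  then have "(\<integral>\<^sup>+y. ennreal (d x y powr - \<beta>) * indicator (X - qball X d x r) y \<partial>M) \<le>
      (\<integral>\<^sup>+y. (\<Sum>j. ennreal ((2 ^ j * r) powr - \<beta>) *
        indicator (qball X d x (2 ^ Suc j * r)) y) \<partial>M)"
    by (intro nn_integral_mono) auto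
  also have "\<dots> = (\<Sum>j. ennreal ((2 ^ j * r) powr - \<beta>) * emeasure M (qball X d x (2 ^ Suc j * r)))"
    by (subst nn_integral_suminf) (auto simp: nn_integral_cmult_indicator)
  finally show ?thesis .
qed

section \<open>Countable nets and exchange of the order of integration\<close>

text \<open>A maximal \<open>\<rho>\<close>-separated set is a net. The balls of radius \<open>\<rho> / (2 K)\<close> around its points are disjoint and
  have positive measure, and a finite measure leaves room for countably many of those only.\<close>
lemma countable_net:
  assumes pos: "\<And>x r. x \<in> X \<Longrightarrow> 0 < r \<Longrightarrow> 0 < emeasure M (qball X d x r)" and "0 < \<rho>"
  obtains N where "countable N" "N \<subseteq> X" "X \<subseteq> (\<Union>z\<in>N. qball X d z \<rho>)"
proof -
  define \<A> where "\<A> = {S. S \<subseteq> X \<and> pairwise (\<lambda>a b. \<rho> \<le> d a b) S}"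
  have "\<exists>N\<in>\<A>. \<forall>S\<in>\<A>. N \<subseteq> S \<longrightarrow> S = N"
  proof (rule subset_Zorn)
    fix C assume "subset.chain \<A> C"
    then have C: "C \<subseteq> \<A>" "\<And>S T. S \<in> C \<Longrightarrow> T \<in> C \<Longrightarrow> S \<subseteq> T \<or> T \<subseteq> S"
      by (auto simp: subset_chain_def)
    have "\<Union>C \<in> \<A>"
      unfolding \<A>_def
    proof (intro CollectI conjI pairwiseI)
      show "\<Union>C \<subseteq> X" using C(1) by (auto simp: \<A>_def)
      fix a b assume "a \<in> \<Union>C" "b \<in> \<Union>C" "a \<noteq> b"
      then obtain S T where ST: "S \<in> C" "T \<in> C" "a \<in> S" "b \<in> T" by blast
      then obtain U where U: "U \<in> C" "a \<in> U" "b \<in> U" using C(2)[OF ST(1,2)] by blast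
      then have "pairwise (\<lambda>a b. \<rho> \<le> d a b) U" using C(1) by (auto simp: \<A>_def)
      with U \<open>a \<noteq> b\<close> show "\<rho> \<le> d a b" by (auto simp: pairwise_def)
    qed
    then show "\<exists>U\<in>\<A>. \<forall>S\<in>C. S \<subseteq> U" by blast
  qed
  then obtain N where "N \<in> \<A>" and maxN: "\<forall>S\<in>\<A>. N \<subseteq> S \<longrightarrow> S = N" by blast
  then have N: "N \<subseteq> X" "pairwise (\<lambda>a b. \<rho> \<le> d a b) N" by (auto simp: \<A>_def)
  define \<delta> where "\<delta> = \<rho> / (2 * K)"
  have \<delta>: "0 < \<delta>" "K * (\<delta> + \<delta>) = \<rho>" using \<open>0 < \<rho>\<close> K_pos by (simp_all add: \<delta>_def)
  have disj: "disjoint_family_on (\<lambda>z. qball X d z \<delta>) N"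
    unfolding disjoint_family_on_def
  proof (intro ballI impI)
    fix a b assume ab: "a \<in> N" "b \<in> N" "a \<noteq> b"
    have False if "y \<in> qball X d a \<delta> \<inter> qball X d b \<delta>" for y
    proof -
      have y: "y \<in> X" "d a y < \<delta>" "d y b < \<delta>" using that ab N(1) by (auto simp: qball_def sym)
      have "d a b \<le> K * (d a y + d y b)" using ab N(1) y tri by blast
      also have "\<dots> < K * (\<delta> + \<delta>)" using y K_pos by (intro mult_strict_left_mono) auto
      also have "\<dots> \<le> d a b" unfolding \<delta>(2) using ab N(2) by (auto simp: pairwise_def)
      finally show False by simp
    qed
    then show "qball X d a \<delta> \<inter> qball X d b \<delta> = {}" by blast
  qed
  have "(\<lambda>z. measure M (qball X d z \<delta>)) summable_on N"
  proof (rule nonneg_bdd_above_summable_on)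
    show "bdd_above (sum (\<lambda>z. measure M (qball X d z \<delta>)) ` {F. F \<subseteq> N \<and> finite F})"
    proof (rule bdd_aboveI2)
      fix F assume F: "F \<in> {F. F \<subseteq> N \<and> finite F}"
      then have "(\<Sum>z\<in>F. measure M (qball X d z \<delta>)) = measure M (\<Union>z\<in>F. qball X d z \<delta>)"
        using N(1) disj
        by (intro finite_measure_finite_Union[symmetric])
          (auto intro: disjoint_family_on_mono)
      also have "\<dots> \<le> measure M (space M)" by (rule bounded_measure)
      finally show "(\<Sum>z\<in>F. measure M (qball X d z \<delta>)) \<le> measure M (space M)" .
    qed
  qed auto
  then have "countable {z \<in> N. measure M (qball X d z \<delta>) \<noteq> 0}"
    by (rule summable_countable_real)
  also have "{z \<in> N. measure M (qball X d z \<delta>) \<noteq> 0} = N"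
    using pos \<delta>(1) N(1) by (force simp: emeasure_eq_measure)
  finally have "countable N" .
  moreover have "X \<subseteq> (\<Union>z\<in>N. qball X d z \<rho>)"
  proof
    fix x assume x: "x \<in> X"
    show "x \<in> (\<Union>z\<in>N. qball X d z \<rho>)"
    proof (rule ccontr)
      assume *: "x \<notin> (\<Union>z\<in>N. qball X d z \<rho>)"
      then have "pairwise (\<lambda>a b. \<rho> \<le> d a b) (insert x N)"
        using N x sym by (force simp: pairwise_insert qball_def)
      then have "insert x N = N" using x N by (intro maxN[rule_format]) (auto simp: \<A>_def)
      then show False using * x zero_iff[of x x] \<open>0 < \<rho>\<close> by (force simp: qball_def)
    qed
  qed
  ultimately show ?thesis using that N(1) by blast
qed

text \<open>For a jointly measurable \<open>d\<close> this would be Tonelli's theorem for the function \<open>g y\<close> on the set of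
  pairs with \<open>d x y < \<rho>\<close>. Instead, \<open>Y\<close> is cut into disjoint measurable cells \<open>D i\<close> around the points
  \<open>z i\<close> of a \<open>\<rho>\<close>-net, and for \<open>x \<in> D i\<close> the ball around \<open>x\<close> is enlarged to a ball \<open>B i\<close> that depends on
  \<open>i\<close> only. Both integrals then become sums, and for fixed \<open>y\<close> the cells with \<open>y \<in> B i\<close> are disjoint
  subsets of one ball around \<open>y\<close>, whose radius comes from applying the quasi-triangle inequality twice.\<close>
lemma ball_measure_swap:
  assumes pos: "\<And>x r. x \<in> X \<Longrightarrow> 0 < r \<Longrightarrow> 0 < emeasure M (qball X d x r)"
    and "0 < \<rho>" and Y: "Y \<in> sets M" and g: "g \<in> borel_measurable M"
    and growth: "\<And>y. y \<in> X \<Longrightarrow> emeasure M (Y \<inter> qball X d y (K * (\<rho> + K * (\<rho> + \<rho>)))) \<le> c"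
  shows "(\<integral>\<^sup>+x. emeasure (density M g) (qball X d x \<rho>) * indicator Y x \<partial>M) \<le> c * (\<integral>\<^sup>+y. g y \<partial>M)"
proof (cases "X = {}")
  case True
  then have "(\<integral>\<^sup>+x. emeasure (density M g) (qball X d x \<rho>) * indicator Y x \<partial>M) = (\<integral>\<^sup>+x. 0 \<partial>M)"
    by (intro nn_integral_cong) auto
  then show ?thesis by simp
next
  case False
  note [measurable] = Y g
  obtain N where N: "countable N" "N \<subseteq> X" "X \<subseteq> (\<Union>z\<in>N. qball X d z \<rho>)"
    using countable_net[OF pos \<open>0 < \<rho>\<close>] by blast
  then have "N \<noteq> {}" using False by auto
  define z where "z = from_nat_into N"
  have ran: "range z = N" using N(1) \<open>N \<noteq> {}\<close> by (simp add: z_def range_from_nat_into)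
  then have zX [simp]: "z i \<in> X" for i using N(2) by auto
  define D where "D i = Y \<inter> disjointed (\<lambda>i. qball X d (z i) \<rho>) i" for i
  define B where "B i = qball X d (z i) (K * (\<rho> + \<rho>))" for i
  have meas [measurable]: "D i \<in> sets M" "B i \<in> sets M" for i
    using sets.range_disjointed_sets[of "\<lambda>i. qball X d (z i) \<rho>" M]
    by (auto simp: D_def B_def image_subset_iff intro!: sets.Int)
  have D_sub: "D i \<subseteq> Y \<inter> qball X d (z i) \<rho>" for i
    using disjointed_subset[of "\<lambda>i. qball X d (z i) \<rho>" i] by (auto simp: D_def)
  have D_disj: "disjoint_family D"
    using disjoint_family_disjointed[of "\<lambda>i. qball X d (z i) \<rho>"]
    unfolding D_def disjoint_family_on_def by blast
  have "Y \<subseteq> (\<Union>i. qball X d (z i) \<rho>)" using N(3) sets.sets_into_space[OF Y] ran by auto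
  then have D_cover: "Y \<subseteq> (\<Union>i. D i)"
    unfolding D_def using UN_disjointed_eq[of "\<lambda>i. qball X d (z i) \<rho>"] by blast
  have "(\<integral>\<^sup>+x. emeasure (density M g) (qball X d x \<rho>) * indicator Y x \<partial>M) \<le>
      (\<integral>\<^sup>+x. (\<Sum>i. emeasure (density M g) (B i) * indicator (D i) x) \<partial>M)"
  proof (rule nn_integral_mono)
    fix x assume x: "x \<in> space M"
    show "emeasure (density M g) (qball X d x \<rho>) * indicator Y x \<le>
        (\<Sum>i. emeasure (density M g) (B i) * indicator (D i) x)"
    proof (cases "x \<in> Y")
      case True
      then obtain i where i: "x \<in> D i" using D_cover by blast
      then have "x \<in> qball X d (z i) \<rho>" using D_sub by blast
      then have "qball X d x \<rho> \<subseteq> B i"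
        unfolding B_def using x by (intro ball_subset_ball) (auto simp: qball_def)
      then have "emeasure (density M g) (qball X d x \<rho>) * indicator Y x \<le>
          emeasure (density M g) (B i) * indicator (D i) x"
        using i True by (auto intro!: emeasure_mono)
      also have "\<dots> \<le> (\<Sum>i. emeasure (density M g) (B i) * indicator (D i) x)"
        by (rule le_suminf_ennreal)
      finally show ?thesis .
    qed auto
  qed
  also have "\<dots> = (\<Sum>i. emeasure (density M g) (B i) * emeasure M (D i))"
    by (subst nn_integral_suminf) (auto simp: nn_integral_cmult_indicator)
  also have "\<dots> = (\<Sum>i. \<integral>\<^sup>+y. g y * indicator (B i) y * emeasure M (D i) \<partial>M)"
    by (intro suminf_cong) (simp add: emeasure_density nn_integral_multc)
  also have "\<dots> = (\<integral>\<^sup>+y. (\<Sum>i. g y * indicator (B i) y * emeasure M (D i)) \<partial>M)"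
    by (rule nn_integral_suminf[symmetric]) measurable
  also have "\<dots> \<le> (\<integral>\<^sup>+y. c * g y \<partial>M)"
  proof (rule nn_integral_mono)
    fix y assume "y \<in> space M"
    then have y: "y \<in> X" by simp
    define E where "E i = (if y \<in> B i then D i else {})" for i
    have [measurable]: "E i \<in> sets M" for i by (simp add: E_def)
    have "(\<Sum>i. g y * indicator (B i) y * emeasure M (D i)) = (\<Sum>i. g y * emeasure M (E i))"
      by (intro suminf_cong) (simp add: E_def)
    also have "\<dots> = g y * (\<Sum>i. emeasure M (E i))" by simp
    also have "(\<Sum>i. emeasure M (E i)) = emeasure M (\<Union>i. E i)"
      using D_disj by (intro suminf_emeasure) (auto simp: E_def disjoint_family_on_def)
    also have "(\<Union>i. E i) \<subseteq> Y \<inter> qball X d y (K * (\<rho> + K * (\<rho> + \<rho>)))"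
    proof
      fix x assume "x \<in> (\<Union>i. E i)"
      then obtain i where i: "x \<in> D i" "y \<in> B i" by (auto simp: E_def split: if_splits)
      then have x: "x \<in> Y" "x \<in> X" "d x (z i) < \<rho>" "d (z i) y < K * (\<rho> + \<rho>)"
        using D_sub[of i] y by (auto simp: qball_def B_def sym)
      have "d x y \<le> K * (d x (z i) + d (z i) y)" using x y tri by auto
      also have "\<dots> < K * (\<rho> + K * (\<rho> + \<rho>))"
        using x K_pos by (intro mult_strict_left_mono) auto
      finally show "x \<in> Y \<inter> qball X d y (K * (\<rho> + K * (\<rho> + \<rho>)))"
        using x by (simp add: qball_def)
    qed
    then have "emeasure M (\<Union>i. E i) \<le> emeasure M (Y \<inter> qball X d y (K * (\<rho> + K * (\<rho> + \<rho>))))"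
      using y by (intro emeasure_mono) auto
    also have "\<dots> \<le> c" using growth[OF y] .
    finally show "(\<Sum>i. g y * indicator (B i) y * emeasure M (D i)) \<le> c * g y"
      by (simp add: mult.commute mult_right_mono)
  qed
  also have "\<dots> = c * (\<integral>\<^sup>+y. g y \<partial>M)" by (rule nn_integral_cmult) simp
  finally show ?thesis .
qed

end

section \<open>Level sets and an elementary Young inequality\<close>

lemma nn_integral_powr_from_0:
  fixes a c :: real
  assumes "0 < a" "0 \<le> c"
  shows "(\<integral>\<^sup>+t. ennreal (a * t powr (a - 1)) * indicator {0<..<c} t \<partial>lborel) = ennreal (c powr a)"
proof -
  have "((\<lambda>t. t powr (a - 1)) has_integral (c powr a / a)) {0..c}"
    using has_integral_powr_from_0[of "a - 1" c] assms by simp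
  then have "((\<lambda>t. t powr (a - 1)) has_integral (c powr a / a)) {0<..<c}"
    by (simp add: has_integral_Icc_iff_Ioo)
  from has_integral_mult_right[OF this, of a]
  have "((\<lambda>t. a * t powr (a - 1)) has_integral c powr a) {0<..<c}" using assms by simp
  then have "(\<integral>\<^sup>+t. ennreal (indicator {0<..<c} t * (a * t powr (a - 1))) \<partial>lborel) = ennreal (c powr a)"
    using assms
    by (intro nn_integral_has_integral_lebesgue) auto
  then show ?thesis
    by (simp add: mult.commute ennreal_mult' flip: ennreal_indicator)
qed

text \<open>The layer cake formula for \<open>(u / c) powr q\<close>. The value \<open>\<infinity>\<close> is kept, since finiteness of potentials
  almost everywhere is deduced from this formula.\<close>
lemma layer_cake_powr:
  fixes q c :: real
  assumes "0 < q" "0 < c"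
  shows "(\<integral>\<^sup>+t. ennreal (q * t powr (q - 1)) * indicator {t. 0 < t \<and> ennreal (c * t) < u} t \<partial>lborel) =
    (if u = \<infinity> then \<infinity> else ennreal ((enn2real u / c) powr q))"
proof (cases u)
  case (real v)
  have "{t. 0 < t \<and> ennreal (c * t) < u} = {0<..<v / c}"
    using real assms by (auto simp: ennreal_less_iff field_simps)
  then show ?thesis using nn_integral_powr_from_0[of q "v / c"] real assms by simp
next
  case top
  let ?I = "\<integral>\<^sup>+t. ennreal (q * t powr (q - 1)) * indicator {t. 0 < t \<and> ennreal (c * t) < u} t \<partial>lborel"
  have "ennreal b \<le> ?I" if "0 \<le> b" for b
  proof -
    have "ennreal b = ennreal ((b powr (1 / q)) powr q)" using assms that by (simp add: powr_powr)
    also have "\<dots> = (\<integral>\<^sup>+t. ennreal (q * t powr (q - 1)) * indicator {0<..<b powr (1 / q)} t \<partial>lborel)"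
      using assms by (intro nn_integral_powr_from_0[symmetric]) auto
    also have "\<dots> \<le> ?I"
      using top by (intro nn_integral_mono mult_left_mono) (auto simp: indicator_def)
    finally show ?thesis .
  qed
  note ge = this
  have "?I = \<infinity>"
  proof (cases ?I)
    case (real v)
    then have "ennreal (v + 1) \<le> ennreal v" using ge[of "v + 1"] by simp
    then show ?thesis using real by (simp del: ennreal_plus)
  qed simp
  then show ?thesis using top by simp
qed

text \<open>One of the two summands alone dominates, according to whether \<open>a \<le> b powr (p - 1)\<close>.\<close>
lemma Young_without_constants:
  fixes a b p :: real
  assumes "0 \<le> a" "0 \<le> b" "1 < p"
  shows "a * b \<le> a powr (p / (p - 1)) + b powr p"
proof (cases "a = 0 \<or> b = 0")
  case False
  then have ab: "0 < a" "0 < b" using assms by auto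
  show ?thesis
  proof (cases "a \<le> b powr (p - 1)")
    case True
    then have "a * b \<le> b powr (p - 1) * b" using ab by simp
    also have "\<dots> = b powr p" using ab by (simp add: powr_diff)
    finally show ?thesis by (simp add: add_increasing)
  next
    case False
    have "b = (b powr (p - 1)) powr (1 / (p - 1))" using ab assms by (simp add: powr_powr)
    also have "\<dots> \<le> a powr (1 / (p - 1))" using False assms by (intro powr_mono2) auto
    finally have "a * b \<le> a * a powr (1 / (p - 1))" using ab by simp
    also have "\<dots> = a powr (1 + 1 / (p - 1))" using ab by (simp add: powr_mult_base)
    also have "1 + 1 / (p - 1) = p / (p - 1)" using assms by (simp add: field_simps)
    finally show ?thesis by (simp add: add_increasing2)
  qed
qed auto

section \<open>Kernel estimates on a piece of fixed dimension\<close>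

text \<open>The ambient measure is bounded by \<open>A * r powr n\<close> only on balls centred in the measurable set \<open>Y\<close>; the
  balls themselves may reach outside \<open>Y\<close>. Positivity of all balls yields the countable nets of
  \<open>countable_net\<close>.\<close>
locale upper_regular_piece = quasi_metric_measure +
  fixes Y :: "'a set" and n A :: real
  assumes Y [measurable]: "Y \<in> sets M" and n_pos: "0 < n" and A_nonneg: "0 \<le> A"
    and growth: "x \<in> Y \<Longrightarrow> 0 < r \<Longrightarrow> emeasure M (qball X d x r) \<le> ennreal (A * r powr n)"
    and ball_pos: "x \<in> X \<Longrightarrow> 0 < r \<Longrightarrow> 0 < emeasure M (qball X d x r)"
begin

lemma Y_subset: "Y \<subseteq> X"
  using sets.sets_into_space[OF Y] by simp

text \<open>If \<open>Y\<close> meets the ball at a point \<open>x\<close>, the ball is contained in one centred at \<open>x\<close>, to which the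
  growth bound applies.\<close>
lemma dual_growth:
  assumes "y \<in> X" "0 < r"
  shows "emeasure M (Y \<inter> qball X d y r) \<le> ennreal (A * (K * (r + r)) powr n)"
proof (cases "Y \<inter> qball X d y r = {}")
  case False
  then obtain x where x: "x \<in> Y" "x \<in> X" "d y x < r" using assms(1) by (auto simp: mem_ball)
  have "emeasure M (Y \<inter> qball X d y r) \<le> emeasure M (qball X d x (K * (r + r)))"
    using ball_subset_ball[of y x r r] assms x by (intro emeasure_mono) auto
  also have "\<dots> \<le> ennreal (A * (K * (r + r)) powr n)"
    using assms K_pos x by (intro growth) auto
  finally show ?thesis .
qed auto

text \<open>A majorant of \<open>\<integral> d(x,y)^(-\<beta>) d\<nu>(y)\<close> over \<open>d(x,y) < r\<close>, by \<open>near_kernel_integral_le\<close>. It is built from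
  measures of balls alone, so that \<open>ball_measure_swap\<close> can be applied scale by scale.\<close>
definition dyadic_potential :: "real \<Rightarrow> real \<Rightarrow> 'a measure \<Rightarrow> 'a \<Rightarrow> ennreal" where
  "dyadic_potential \<beta> r \<nu> x =
    (\<Sum>j. ennreal ((r / 2 ^ Suc j) powr - \<beta>) * emeasure \<nu> (qball X d x (r / 2 ^ j)))"

lemma dyadic_potential_measurable:
  assumes "sets \<nu> = sets M"
  shows "dyadic_potential \<beta> r \<nu> \<in> borel_measurable M"
proof -
  have [measurable]: "(\<lambda>x. emeasure \<nu> (qball X d x s)) \<in> borel_measurable M" for s
    using lsc_measurable[OF lsc_ball_measure[OF assms]] .
  show ?thesis unfolding dyadic_potential_def[abs_def] by measurable
qed

lemma near_kernel_bounded: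
  assumes "0 < \<beta>" "\<beta> < n"
  shows "\<exists>C\<ge>0. \<forall>x\<in>Y. \<forall>r>0.
    (\<integral>\<^sup>+y. ennreal (d x y powr - \<beta>) * indicator (qball X d x r) y \<partial>M) \<le> ennreal (C * r powr (n - \<beta>))"
proof (intro exI conjI ballI allI impI)
  show "0 \<le> A * 2 powr \<beta> / (1 - 2 powr (\<beta> - n))"
    using A_nonneg assms powr_less_mono[of "\<beta> - n" 0 2] by simp
  fix x and r :: real
  assume x: "x \<in> Y" and r: "0 < r"
  have "(\<integral>\<^sup>+y. ennreal (d x y powr - \<beta>) * indicator (qball X d x r) y \<partial>M) \<le>
      (\<Sum>j. ennreal ((r / 2 ^ Suc j) powr - \<beta>) * emeasure M (qball X d x (r / 2 ^ j)))"
    using x Y_subset r assms by (intro near_kernel_integral_le) auto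
  also have "\<dots> \<le> (\<Sum>j. ennreal ((r / 2 ^ Suc j) powr - \<beta>) * ennreal (A * (r / 2 ^ j) powr n))"
    using x r by (intro suminf_le mult_left_mono growth) auto
  also have "\<dots> = ennreal (A * 2 powr \<beta> / (1 - 2 powr (\<beta> - n)) * r powr (n - \<beta>))"
    using A_nonneg r assms by (intro near_scales_sum) auto
  finally show "(\<integral>\<^sup>+y. ennreal (d x y powr - \<beta>) * indicator (qball X d x r) y \<partial>M) \<le>
      ennreal (A * 2 powr \<beta> / (1 - 2 powr (\<beta> - n)) * r powr (n - \<beta>))" .
qed

lemma far_kernel_bounded:
  assumes "n < \<beta>"
  shows "\<exists>C\<ge>0. \<forall>x\<in>Y. \<forall>r>0.
    (\<integral>\<^sup>+y. ennreal (d x y powr - \<beta>) * indicator (X - qball X d x r) y \<partial>M) \<le> ennreal (C * r powr (n - \<beta>))"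
proof (intro exI conjI ballI allI impI)
  show "0 \<le> A * 2 powr n / (1 - 2 powr (n - \<beta>))"
    using A_nonneg assms powr_less_mono[of "n - \<beta>" 0 2] by simp
  fix x and r :: real
  assume x: "x \<in> Y" and r: "0 < r"
  have "(\<integral>\<^sup>+y. ennreal (d x y powr - \<beta>) * indicator (X - qball X d x r) y \<partial>M) \<le>
      (\<Sum>j. ennreal ((2 ^ j * r) powr - \<beta>) * emeasure M (qball X d x (2 ^ Suc j * r)))"
    using x Y_subset r assms n_pos by (intro far_kernel_integral_le) auto
  also have "\<dots> \<le> (\<Sum>j. ennreal ((2 ^ j * r) powr - \<beta>) * ennreal (A * (2 ^ Suc j * r) powr n))"
    using x r by (intro suminf_le mult_left_mono growth) auto
  also have "\<dots> = ennreal (A * 2 powr n / (1 - 2 powr (n - \<beta>)) * r powr (n - \<beta>))"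
    using A_nonneg r assms by (intro far_scales_sum) auto
  finally show "(\<integral>\<^sup>+y. ennreal (d x y powr - \<beta>) * indicator (X - qball X d x r) y \<partial>M) \<le>
      ennreal (A * 2 powr n / (1 - 2 powr (n - \<beta>)) * r powr (n - \<beta>))" .
qed

text \<open>Here the dual growth bound enters: integrated over \<open>x \<in> Y\<close>, the scale \<open>\<rho>\<close> of the potential is
  at most a constant multiple of \<open>\<rho> powr (n - \<beta>)\<close> times the total mass, and the scales sum up geometrically.\<close>
lemma dyadic_potential_L1:
  assumes "0 < \<beta>" "\<beta> < n"
  shows "\<exists>C\<ge>0. \<forall>r>0. \<forall>g\<in>borel_measurable M.
    (\<integral>\<^sup>+x. dyadic_potential \<beta> r (density M g) x * indicator Y x \<partial>M) \<le>
      ennreal (C * r powr (n - \<beta>)) * (\<integral>\<^sup>+y. g y \<partial>M)"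
proof (intro exI conjI ballI allI impI)
  \<comment> \<open>\<open>L * \<rho>\<close> is the radius that results from the enlargement in \<open>ball_measure_swap\<close> and the recentring in \<open>dual_growth\<close>.\<close>
  define L where "L = 2 * K * (K * (1 + 2 * K))"
  define A' where "A' = A * L powr n"
  have L: "0 < L" "0 \<le> A'" using K_pos A_nonneg by (auto simp: L_def A'_def intro!: mult_pos_pos)
  show "0 \<le> A' * 2 powr \<beta> / (1 - 2 powr (\<beta> - n))"
    using L assms powr_less_mono[of "\<beta> - n" 0 2] by simp
  fix r :: real and g :: "'a \<Rightarrow> ennreal"
  assume r: "0 < r" and g [measurable]: "g \<in> borel_measurable M"
  have [measurable]: "(\<lambda>x. emeasure (density M g) (qball X d x s)) \<in> borel_measurable M" for s
    by (intro lsc_measurable lsc_ball_measure) simp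
  have ball: "(\<integral>\<^sup>+x. emeasure (density M g) (qball X d x \<rho>) * indicator Y x \<partial>M) \<le>
      ennreal (A' * \<rho> powr n) * (\<integral>\<^sup>+y. g y \<partial>M)" if "0 < \<rho>" for \<rho>
  proof (rule ball_measure_swap[OF ball_pos that Y g])
    fix y assume y: "y \<in> X"
    let ?s = "K * (\<rho> + K * (\<rho> + \<rho>))"
    have "emeasure M (Y \<inter> qball X d y ?s) \<le> ennreal (A * (K * (?s + ?s)) powr n)"
      using y that K_pos by (intro dual_growth) (auto intro!: mult_pos_pos add_pos_pos)
    also have "K * (?s + ?s) = L * \<rho>" by (simp add: L_def algebra_simps)
    finally show "emeasure M (Y \<inter> qball X d y ?s) \<le> ennreal (A' * \<rho> powr n)"
      using L that by (simp add: A'_def powr_mult mult.assoc)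
  qed
  have "(\<integral>\<^sup>+x. dyadic_potential \<beta> r (density M g) x * indicator Y x \<partial>M) =
      (\<integral>\<^sup>+x. (\<Sum>j. ennreal ((r / 2 ^ Suc j) powr - \<beta>) *
        (emeasure (density M g) (qball X d x (r / 2 ^ j)) * indicator Y x)) \<partial>M)"
    unfolding dyadic_potential_def by (simp only: ennreal_suminf_multc[symmetric] mult.assoc)
  also have "\<dots> = (\<Sum>j. ennreal ((r / 2 ^ Suc j) powr - \<beta>) *
      (\<integral>\<^sup>+x. emeasure (density M g) (qball X d x (r / 2 ^ j)) * indicator Y x \<partial>M))"
    by (subst nn_integral_suminf) (auto simp: nn_integral_cmult)
  also have "\<dots> \<le> (\<Sum>j. ennreal ((r / 2 ^ Suc j) powr - \<beta>) *
      (ennreal (A' * (r / 2 ^ j) powr n) * (\<integral>\<^sup>+y. g y \<partial>M)))"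
    using r by (intro suminf_le mult_left_mono ball) auto
  also have "\<dots> = (\<Sum>j. ennreal ((r / 2 ^ Suc j) powr - \<beta>) * ennreal (A' * (r / 2 ^ j) powr n)) *
      (\<integral>\<^sup>+y. g y \<partial>M)"
    by (simp only: ennreal_suminf_multc[symmetric] mult.assoc)
  also have "(\<Sum>j. ennreal ((r / 2 ^ Suc j) powr - \<beta>) * ennreal (A' * (r / 2 ^ j) powr n)) =
      ennreal (A' * 2 powr \<beta> / (1 - 2 powr (\<beta> - n)) * r powr (n - \<beta>))"
    using L r assms by (intro near_scales_sum) auto
  finally show "(\<integral>\<^sup>+x. dyadic_potential \<beta> r (density M g) x * indicator Y x \<partial>M) \<le>
      ennreal (A' * 2 powr \<beta> / (1 - 2 powr (\<beta> - n)) * r powr (n - \<beta>)) * (\<integral>\<^sup>+y. g y \<partial>M)" .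
qed

text \<open>Young's inequality is applied to \<open>k / R\<close> and \<open>g\<close>, where \<open>k\<close> is the kernel and
  \<open>R = r powr (\<alpha> - n / p)\<close> is the expected bound. With \<open>p' = p / (p - 1)\<close>, the condition
  \<open>\<alpha> * p < n\<close> says that \<open>(n - \<alpha>) * p' > n\<close>, so \<open>k powr p'\<close> is integrable at large distances, and its integral is
  of the order \<open>R powr p'\<close>.\<close>
lemma far_part_le:
  assumes "0 < \<alpha>" "1 < p" "\<alpha> * p < n"
  shows "\<exists>C\<ge>0. \<forall>x\<in>Y. \<forall>r>0. \<forall>g\<in>borel_measurable M. (\<forall>y. 0 \<le> g y) \<longrightarrow>
    (\<integral>\<^sup>+y. ennreal (g y powr p) \<partial>M) \<le> 1 \<longrightarrow>
    (\<integral>\<^sup>+y. ennreal (d x y powr - (n - \<alpha>)) * ennreal (g y) * indicator (X - qball X d x r) y \<partial>M)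
      \<le> ennreal (C * r powr (\<alpha> - n / p))"
proof -
  define p' where "p' = p / (p - 1)"
  define \<beta> where "\<beta> = (n - \<alpha>) * p'"
  have p': "0 < p'" "p' / p = p' - 1" using assms by (auto simp: p'_def field_simps)
  have "n < \<beta>"
    using assms by (simp add: \<beta>_def p'_def field_simps)
  then obtain C where C: "C \<ge> 0" "\<And>x r. x \<in> Y \<Longrightarrow> r > 0 \<Longrightarrow>
      (\<integral>\<^sup>+y. ennreal (d x y powr - \<beta>) * indicator (X - qball X d x r) y \<partial>M) \<le> ennreal (C * r powr (n - \<beta>))"
    using far_kernel_bounded[of \<beta>] by blast
  show ?thesis
  proof (intro exI[of _ "C + 1"] conjI ballI allI impI)
    fix x and r :: real and g :: "'a \<Rightarrow> real"
    assume x: "x \<in> Y" and r: "0 < r" and [measurable]: "g \<in> borel_measurable M"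
      and g: "\<forall>y. 0 \<le> g y" "(\<integral>\<^sup>+y. ennreal (g y powr p) \<partial>M) \<le> 1"
    have xX: "x \<in> X" using x Y_subset by auto
    note [measurable] = dist_measurable[OF xX] ball_measurable[OF xX]
    have [measurable]: "X - qball X d x r \<in> sets M"
      using sets.compl_sets[OF ball_measurable[OF xX, of r]] by simp
    define R where "R = r powr (\<alpha> - n / p)"
    have R: "0 < R" using r by (simp add: R_def)
    define k where "k y = d x y powr - (n - \<alpha>)" for y
    have kp: "(k y / R) powr p' = R powr - p' * d x y powr - \<beta>" for y
    proof -
      have "- (n - \<alpha>) * p' = - \<beta>" by (simp add: \<beta>_def algebra_simps)
      then have "k y powr p' = d x y powr - \<beta>" by (simp only: k_def powr_powr)
      moreover have "(k y / R) powr p' = k y powr p' / R powr p'"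
        using R by (simp add: k_def powr_divide)
      ultimately show ?thesis by (simp add: powr_minus[of R] divide_inverse mult.commute)
    qed
    have young: "ennreal (k y) * ennreal (g y) \<le>
        ennreal R * (ennreal (R powr - p') * ennreal (d x y powr - \<beta>) + ennreal (g y powr p))" for y
    proof -
      have "k y / R * g y \<le> (k y / R) powr p' + g y powr p"
        unfolding p'_def using g R assms by (intro Young_without_constants) (auto simp: k_def)
      then have "R * (k y / R * g y) \<le> R * (R powr - p' * d x y powr - \<beta> + g y powr p)"
        unfolding kp using R by (intro mult_left_mono) auto
      also have "R * (k y / R * g y) = k y * g y" using R by simp
      finally have "ennreal (k y * g y) \<le> ennreal (R * (R powr - p' * d x y powr - \<beta> + g y powr p))"
        by (rule ennreal_leI)
      then show ?thesis using g R by (simp add: ennreal_mult k_def)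
    qed
    have exponent: "R powr - p' * r powr (n - \<beta>) = 1"
    proof -
      have "(\<alpha> - n / p) * - p' + (n - \<beta>) = n * (p' / p - p' + 1)"
        by (simp add: \<beta>_def algebra_simps)
      also have "\<dots> = 0" using p' by simp
      finally show ?thesis using r by (simp add: R_def powr_powr flip: powr_add)
    qed
    have "(\<integral>\<^sup>+y. ennreal (k y) * ennreal (g y) * indicator (X - qball X d x r) y \<partial>M) \<le>
        (\<integral>\<^sup>+y. ennreal R * (ennreal (R powr - p') * (ennreal (d x y powr - \<beta>) *
          indicator (X - qball X d x r) y) + ennreal (g y powr p)) \<partial>M)"
      using young by (intro nn_integral_mono) (auto split: split_indicator)
    also have "\<dots> = ennreal R * (ennreal (R powr - p') *
        (\<integral>\<^sup>+y. ennreal (d x y powr - \<beta>) * indicator (X - qball X d x r) y \<partial>M) +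
        (\<integral>\<^sup>+y. ennreal (g y powr p) \<partial>M))"
      by (subst nn_integral_cmult, measurable, subst nn_integral_add, measurable,
          subst nn_integral_cmult, measurable)
    also have "\<dots> \<le> ennreal R * (ennreal (R powr - p') * ennreal (C * r powr (n - \<beta>)) + 1)"
      using g(2) C(2)[OF x r] by (intro mult_left_mono add_mono) auto
    also have "\<dots> = ennreal R * ennreal (C + 1)"
    proof -
      have "ennreal (R powr - p') * ennreal (C * r powr (n - \<beta>)) = ennreal C"
        using exponent C(1) by (simp add: mult.left_commute flip: ennreal_mult')
      then show ?thesis using C(1) by simp
    qed
    also have "\<dots> = ennreal ((C + 1) * r powr (\<alpha> - n / p))"
      using R C(1) by (subst ennreal_mult[symmetric]) (simp_all add: R_def mult.commute)
    finally show "(\<integral>\<^sup>+y. ennreal (d x y powr - (n - \<alpha>)) * ennreal (g y) *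
        indicator (X - qball X d x r) y \<partial>M) \<le> ennreal ((C + 1) * r powr (\<alpha> - n / p))"
      unfolding k_def .
  qed (use C in auto)
qed

section \<open>The Hardy-Littlewood-Sobolev inequality on a piece\<close>

text \<open>The radius \<open>r = t powr (- q / n)\<close> and the height \<open>s = t powr (q / p)\<close> are determined by the requirement
  that \<open>r powr (\<alpha> - n / p)\<close> (the far part) and \<open>s * r powr \<alpha>\<close> (the near part of \<open>g\<close> below \<open>s\<close>) are both
  equal to \<open>t\<close>; this is possible by the relation between \<open>p\<close> and \<open>q\<close>. The constant is written
  as \<open>c - 1\<close> to leave room for the remaining near part in the comparison with \<open>c * t\<close>.\<close>
lemma potential_split_le:
  assumes \<alpha>: "0 < \<alpha>" and p: "1 < p" "\<alpha> * p < n" and q: "0 < q" "1 / q = 1 / p - \<alpha> / n"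
  shows "\<exists>c\<ge>1. \<forall>x\<in>Y. \<forall>t>0. \<forall>g\<in>borel_measurable M. (\<forall>y. 0 \<le> g y) \<longrightarrow>
    (\<integral>\<^sup>+y. ennreal (g y powr p) \<partial>M) \<le> 1 \<longrightarrow>
    (\<integral>\<^sup>+y. ennreal (d x y powr - (n - \<alpha>)) * ennreal (g y) \<partial>M) \<le> ennreal ((c - 1) * t) +
      dyadic_potential (n - \<alpha>) (t powr (- q / n))
        (density M (\<lambda>y. ennreal (g y) * indicator {y. t powr (q / p) < g y} y)) x"
proof -
  have "\<alpha> * 1 < \<alpha> * p" using \<alpha> p(1) by (intro mult_strict_left_mono)
  then have \<alpha>n: "0 < n - \<alpha>" "n - \<alpha> < n" using \<alpha> p(2) by linarith+
  obtain C1 where C1: "C1 \<ge> 0" "\<And>x r g. x \<in> Y \<Longrightarrow> r > 0 \<Longrightarrow> g \<in> borel_measurable M \<Longrightarrow>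
      (\<forall>y. 0 \<le> g y) \<Longrightarrow> (\<integral>\<^sup>+y. ennreal (g y powr p) \<partial>M) \<le> 1 \<Longrightarrow>
      (\<integral>\<^sup>+y. ennreal (d x y powr - (n - \<alpha>)) * ennreal (g y) * indicator (X - qball X d x r) y \<partial>M)
        \<le> ennreal (C1 * r powr (\<alpha> - n / p))"
    using far_part_le[OF \<alpha> p] by blast
  obtain C2 where C2: "C2 \<ge> 0" "\<And>x r. x \<in> Y \<Longrightarrow> r > 0 \<Longrightarrow>
      (\<integral>\<^sup>+y. ennreal (d x y powr - (n - \<alpha>)) * indicator (qball X d x r) y \<partial>M) \<le> ennreal (C2 * r powr \<alpha>)"
    using near_kernel_bounded[OF \<alpha>n] by auto
  show ?thesis
  proof (intro exI[of _ "C1 + C2 + 1"] conjI ballI allI impI)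
    fix x and t :: real and g :: "'a \<Rightarrow> real"
    assume x: "x \<in> Y" and t: "0 < t" and [measurable]: "g \<in> borel_measurable M"
      and g: "\<forall>y. 0 \<le> g y" "(\<integral>\<^sup>+y. ennreal (g y powr p) \<partial>M) \<le> 1"
    have xX: "x \<in> X" using x Y_subset by auto
    note [measurable] = dist_measurable[OF xX] ball_measurable[OF xX]
    define r where "r = t powr (- q / n)"
    define s where "s = t powr (q / p)"
    have rs: "0 < r" "0 < s" using t by (auto simp: r_def s_def)
    have [measurable]: "X - qball X d x r \<in> sets M"
      using sets.compl_sets[OF ball_measurable[OF xX, of r]] by simp
    define h where "h y = ennreal (g y) * indicator {y. s < g y} y" for y
    have [measurable]: "h \<in> borel_measurable M"
    proof -
      have "h = (\<lambda>y. ennreal (if s < g y then g y else 0))" by (auto simp: h_def)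
      then show ?thesis by simp
    qed
    define k where "k y = ennreal (d x y powr - (n - \<alpha>))" for y
    have [measurable]: "k \<in> borel_measurable M" unfolding k_def by measurable
    have e1: "r powr (\<alpha> - n / p) = t"
    proof -
      have "(- q / n) * (\<alpha> - n / p) = q * (1 / p - \<alpha> / n)" using n_pos p(1) by (simp add: field_simps)
      also have "\<dots> = 1" using q by (simp flip: q(2))
      finally show ?thesis using t by (simp only: r_def powr_powr) simp
    qed
    have e2: "s * r powr \<alpha> = t"
    proof -
      have "q / p + (- q / n) * \<alpha> = q * (1 / p - \<alpha> / n)" using n_pos p(1) by (simp add: field_simps)
      also have "\<dots> = 1" using q by (simp flip: q(2))
      finally show ?thesis using t by (simp only: r_def s_def powr_powr powr_add[symmetric]) simp
    qed
    have "(\<integral>\<^sup>+y. k y * ennreal (g y) \<partial>M) \<le>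
        (\<integral>\<^sup>+y. k y * ennreal (g y) * indicator (X - qball X d x r) y +
          (ennreal s * (k y * indicator (qball X d x r) y) +
           h y * (k y * indicator (qball X d x r) y)) \<partial>M)"
    proof (rule nn_integral_mono)
      fix y assume "y \<in> space M"
      then have y: "y \<in> X" by simp
      show "k y * ennreal (g y) \<le> k y * ennreal (g y) * indicator (X - qball X d x r) y +
          (ennreal s * (k y * indicator (qball X d x r) y) +
           h y * (k y * indicator (qball X d x r) y))"
      proof (cases "y \<in> qball X d x r")
        case True
        show ?thesis
        proof (cases "s < g y")
          case True
          then show ?thesis using \<open>y \<in> qball X d x r\<close> by (simp add: h_def mult.commute)
        next
          case False
          then have "ennreal (g y) \<le> ennreal s" by (intro ennreal_leI) simp
          then show ?thesis using \<open>y \<in> qball X d x r\<close> False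
            by (simp add: h_def mult.commute[of "ennreal s"] mult_left_mono)
        qed
      qed (use y in simp)
    qed
    also have "\<dots> = (\<integral>\<^sup>+y. k y * ennreal (g y) * indicator (X - qball X d x r) y \<partial>M) +
        (ennreal s * (\<integral>\<^sup>+y. k y * indicator (qball X d x r) y \<partial>M) +
         (\<integral>\<^sup>+y. h y * (k y * indicator (qball X d x r) y) \<partial>M))"
      by (subst nn_integral_add, measurable, subst nn_integral_add, measurable,
          subst nn_integral_cmult, measurable)
    also have "(\<integral>\<^sup>+y. h y * (k y * indicator (qball X d x r) y) \<partial>M) =
        (\<integral>\<^sup>+y. k y * indicator (qball X d x r) y \<partial>density M h)"
      by (rule nn_integral_density[symmetric]) measurable
    also have "\<dots> \<le> dyadic_potential (n - \<alpha>) r (density M h) x"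
      unfolding k_def dyadic_potential_def
      using rs \<alpha>n xX by (intro near_kernel_integral_le) auto
    also have "(\<integral>\<^sup>+y. k y * ennreal (g y) * indicator (X - qball X d x r) y \<partial>M) \<le> ennreal (C1 * t)"
      unfolding k_def using C1(2)[OF x rs(1) _ g] by (simp add: e1)
    also have "ennreal s * (\<integral>\<^sup>+y. k y * indicator (qball X d x r) y \<partial>M) \<le> ennreal (C2 * t)"
    proof -
      have "ennreal s * (\<integral>\<^sup>+y. k y * indicator (qball X d x r) y \<partial>M) \<le>
          ennreal s * ennreal (C2 * r powr \<alpha>)"
        unfolding k_def using C2(2)[OF x rs(1)] by (intro mult_left_mono) auto
      also have "\<dots> = ennreal (C2 * (s * r powr \<alpha>))"
        using rs C2(1) by (simp add: mult_ac flip: ennreal_mult')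
      finally show ?thesis by (simp only: e2)
    qed
    finally have "(\<integral>\<^sup>+y. k y * ennreal (g y) \<partial>M) \<le>
        ennreal (C1 * t) + (ennreal (C2 * t) + dyadic_potential (n - \<alpha>) r (density M h) x)"
      by (simp add: add_mono)
    also have "\<dots> = ennreal ((C1 + C2 + 1 - 1) * t) + dyadic_potential (n - \<alpha>) r (density M h) x"
      using C1(1) C2(1) t by (simp add: add.assoc[symmetric] distrib_right)
    finally show "(\<integral>\<^sup>+y. ennreal (d x y powr - (n - \<alpha>)) * ennreal (g y) \<partial>M) \<le>
        ennreal ((C1 + C2 + 1 - 1) * t) + dyadic_potential (n - \<alpha>) (t powr (- q / n))
          (density M (\<lambda>y. ennreal (g y) * indicator {y. t powr (q / p) < g y} y)) x"
      unfolding k_def h_def[abs_def] r_def s_def .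
  qed (use C1(1) C2(1) in simp)
qed

text \<open>By \<open>potential_split_le\<close>, on the level set the near potential of the part of \<open>g\<close> above \<open>t powr (q / p)\<close>
  is at least \<open>t\<close>. Chebyshev's inequality in \<open>L^1\<close> bounds the measure of this set, and the resulting power
  of \<open>t\<close> is \<open>r powr \<alpha> / t = t powr (- q / p)\<close>.\<close>
lemma distribution_le:
  assumes \<alpha>: "0 < \<alpha>" and p: "1 < p" "\<alpha> * p < n" and q: "0 < q" "1 / q = 1 / p - \<alpha> / n"
  shows "\<exists>c\<ge>1. \<exists>C\<ge>0. \<forall>t>0. \<forall>g\<in>borel_measurable M. (\<forall>y. 0 \<le> g y) \<longrightarrow>
    (\<integral>\<^sup>+y. ennreal (g y powr p) \<partial>M) \<le> 1 \<longrightarrow>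
    emeasure M {x \<in> Y. ennreal (c * t) < (\<integral>\<^sup>+y. ennreal (d x y powr - (n - \<alpha>)) * ennreal (g y) \<partial>M)} \<le>
      ennreal (C * t powr (- q / p)) *
        (\<integral>\<^sup>+y. ennreal (g y) * indicator {y. t powr (q / p) < g y} y \<partial>M)"
proof -
  have "\<alpha> * 1 < \<alpha> * p" using \<alpha> p(1) by (intro mult_strict_left_mono)
  then have \<alpha>n: "0 < n - \<alpha>" "n - \<alpha> < n" using \<alpha> p(2) by linarith+
  obtain c where c: "c \<ge> 1" "\<And>x t g. x \<in> Y \<Longrightarrow> t > 0 \<Longrightarrow> g \<in> borel_measurable M \<Longrightarrow>
      (\<forall>y. 0 \<le> g y) \<Longrightarrow> (\<integral>\<^sup>+y. ennreal (g y powr p) \<partial>M) \<le> 1 \<Longrightarrow>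
      (\<integral>\<^sup>+y. ennreal (d x y powr - (n - \<alpha>)) * ennreal (g y) \<partial>M) \<le> ennreal ((c - 1) * t) +
      dyadic_potential (n - \<alpha>) (t powr (- q / n))
        (density M (\<lambda>y. ennreal (g y) * indicator {y. t powr (q / p) < g y} y)) x"
    using potential_split_le[OF assms] by blast
  obtain C where C: "C \<ge> 0" "\<And>r g. r > 0 \<Longrightarrow> g \<in> borel_measurable M \<Longrightarrow>
    (\<integral>\<^sup>+x. dyadic_potential (n - \<alpha>) r (density M g) x * indicator Y x \<partial>M) \<le>
      ennreal (C * r powr \<alpha>) * (\<integral>\<^sup>+y. g y \<partial>M)"
    using dyadic_potential_L1[OF \<alpha>n] by auto
  show ?thesis
  proof (rule exI[of _ c], intro exI[of _ C] conjI ballI allI impI)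
    fix t :: real and g :: "'a \<Rightarrow> real"
    assume t: "0 < t" and gm [measurable]: "g \<in> borel_measurable M"
      and g: "\<forall>y. 0 \<le> g y" "(\<integral>\<^sup>+y. ennreal (g y powr p) \<partial>M) \<le> 1"
    define r where "r = t powr (- q / n)"
    have r: "0 < r" using t by (simp add: r_def)
    define h where "h y = ennreal (g y) * indicator {y. t powr (q / p) < g y} y" for y
    have hm [measurable]: "h \<in> borel_measurable M"
    proof -
      have "h = (\<lambda>y. ennreal (if t powr (q / p) < g y then g y else 0))" by (auto simp: h_def)
      then show ?thesis by simp
    qed
    define S where "S = dyadic_potential (n - \<alpha>) r (density M h)"
    have [measurable]: "S \<in> borel_measurable M"
      unfolding S_def by (rule dyadic_potential_measurable) simp
    have "{x \<in> Y. ennreal (c * t) < (\<integral>\<^sup>+y. ennreal (d x y powr - (n - \<alpha>)) * ennreal (g y) \<partial>M)} \<subseteq>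
        {x \<in> Y. 1 \<le> ennreal (1 / t) * S x}"
    proof safe
      fix x assume x: "x \<in> Y" and
        *: "ennreal (c * t) < (\<integral>\<^sup>+y. ennreal (d x y powr - (n - \<alpha>)) * ennreal (g y) \<partial>M)"
      have lt: "ennreal (c * t) < ennreal ((c - 1) * t) + S x"
        using * c(2)[OF x t gm g] unfolding S_def r_def h_def[abs_def] by (rule less_le_trans)
      have "ennreal t \<le> S x"
      proof (cases "S x")
        case (real v)
        have "ennreal (c * t) < ennreal ((c - 1) * t + v)"
          using lt real t c(1) by simp
        then have "c * t < (c - 1) * t + v" using t c(1) by (simp add: ennreal_less_iff)
        then show ?thesis using real by (auto simp: algebra_simps intro: ennreal_leI)
      qed simp
      then have "ennreal (1 / t) * ennreal t \<le> ennreal (1 / t) * S x" by (rule mult_left_mono) simp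
      then show "1 \<le> ennreal (1 / t) * S x" using t by (simp flip: ennreal_mult')
    qed
    then have "emeasure M {x \<in> Y. ennreal (c * t) < (\<integral>\<^sup>+y. ennreal (d x y powr - (n - \<alpha>)) * ennreal (g y) \<partial>M)} \<le>
        emeasure M {x \<in> Y. 1 \<le> ennreal (1 / t) * S x}"
      by (rule emeasure_mono) measurable
    also have "\<dots> \<le> ennreal (1 / t) * (\<integral>\<^sup>+x. S x * indicator Y x \<partial>M)"
      by (rule nn_integral_Markov_inequality) measurable
    also have "\<dots> \<le> ennreal (1 / t) * (ennreal (C * r powr \<alpha>) * (\<integral>\<^sup>+y. h y \<partial>M))"
      unfolding S_def by (intro mult_left_mono C r hm) auto
    also have "\<dots> = ennreal (C * (r powr \<alpha> / t)) * (\<integral>\<^sup>+y. h y \<partial>M)"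
      using t C(1) by (simp add: mult.assoc[symmetric] flip: ennreal_mult')
    also have "r powr \<alpha> / t = t powr (- q / p)"
    proof -
      have "(- q / n) * \<alpha> - 1 = q * (1 / p - \<alpha> / n) - q / p - 1" by (simp add: field_simps)
      also have "\<dots> = - q / p" using q by (simp flip: q(2))
      finally have "t powr (- q / p) = t powr ((- q / n) * \<alpha> - 1)" by simp
      also have "\<dots> = r powr \<alpha> / t" using t by (simp only: r_def powr_powr powr_diff) simp
      finally show ?thesis by simp
    qed
    finally show "emeasure M {x \<in> Y. ennreal (c * t) <
          (\<integral>\<^sup>+y. ennreal (d x y powr - (n - \<alpha>)) * ennreal (g y) \<partial>M)} \<le>
        ennreal (C * t powr (- q / p)) *
        (\<integral>\<^sup>+y. ennreal (g y) * indicator {y. t powr (q / p) < g y} y \<partial>M)"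
      unfolding h_def[abs_def] .
  qed (use c C in auto)
qed

text \<open>The bound of \<open>distribution_le\<close> is integrated against \<open>q * t powr (q - 1)\<close>. For fixed \<open>y\<close> the level \<open>t\<close>
  ranges over \<open>0 < t < g y powr (p / q)\<close>, and with \<open>a = q - q / p\<close>, which is positive as \<open>p > 1\<close>, the integral
  of \<open>t powr (a - 1)\<close> over this interval is \<open>g y powr (p - 1) / a\<close>. The variables exchanged are a
  point and a real level, so that Tonelli's theorem is available here.\<close>
lemma potential_strong_type:
  assumes \<alpha>: "0 < \<alpha>" and p: "1 < p" "\<alpha> * p < n" and q: "0 < q" "1 / q = 1 / p - \<alpha> / n"
  shows "\<exists>C\<ge>1. \<forall>g\<in>borel_measurable M. (\<forall>y. 0 \<le> g y) \<longrightarrow>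
    (\<integral>\<^sup>+y. ennreal (g y powr p) \<partial>M) \<le> 1 \<longrightarrow>
    (AE x in M. x \<in> Y \<longrightarrow> (\<integral>\<^sup>+y. ennreal (d x y powr - (n - \<alpha>)) * ennreal (g y) \<partial>M) < \<infinity>) \<and>
    (\<integral>\<^sup>+x. ennreal (enn2real (\<integral>\<^sup>+y. ennreal (d x y powr - (n - \<alpha>)) * ennreal (g y) \<partial>M) powr q) *
      indicator Y x \<partial>M) \<le> ennreal C"
proof -
  have "\<alpha> * 1 < \<alpha> * p" using \<alpha> p(1) by (intro mult_strict_left_mono)
  then have \<alpha>n: "0 < n - \<alpha>" using p(2) by linarith
  obtain c C where c: "c \<ge> 1" and C: "C \<ge> 0" and dist: "\<And>t g. t > 0 \<Longrightarrow> g \<in> borel_measurable M \<Longrightarrow>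
    (\<forall>y. 0 \<le> g y) \<Longrightarrow> (\<integral>\<^sup>+y. ennreal (g y powr p) \<partial>M) \<le> 1 \<Longrightarrow>
    emeasure M {x \<in> Y. ennreal (c * t) < (\<integral>\<^sup>+y. ennreal (d x y powr - (n - \<alpha>)) * ennreal (g y) \<partial>M)} \<le>
      ennreal (C * t powr (- q / p)) *
        (\<integral>\<^sup>+y. ennreal (g y) * indicator {y. t powr (q / p) < g y} y \<partial>M)"
    using distribution_le[OF assms] by blast
  define a where "a = q - q / p"
  have "q / p < q" using p(1) q(1) by (simp add: divide_less_eq)
  then have a: "0 < a" by (simp add: a_def)
  define D where "D = C * q / a"
  have D: "0 \<le> D" using C q a by (simp add: D_def)
  interpret P: pair_sigma_finite M lborel ..
  show ?thesis
  proof (intro exI[of _ "max 1 (c powr q * D)"] conjI ballI impI)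
    fix g :: "'a \<Rightarrow> real"
    assume gm [measurable]: "g \<in> borel_measurable M"
      and g: "\<forall>y. 0 \<le> g y" "(\<integral>\<^sup>+y. ennreal (g y powr p) \<partial>M) \<le> 1"
    define T where "T x = (\<integral>\<^sup>+y. ennreal (d x y powr - (n - \<alpha>)) * ennreal (g y) \<partial>M)" for x
    have [measurable]: "T \<in> borel_measurable M"
      unfolding T_def using \<alpha>n by (intro potential_measurable) auto
    define L where "L x = (\<integral>\<^sup>+t. ennreal (q * t powr (q - 1)) *
      indicator {t. 0 < t \<and> ennreal (c * t) < T x} t \<partial>lborel)" for x
    have L: "L x = (if T x = \<infinity> then \<infinity> else ennreal ((enn2real (T x) / c) powr q))" for x
      unfolding L_def using q(1) c by (intro layer_cake_powr) auto
    have [measurable]: "L \<in> borel_measurable M" unfolding L by measurable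
    have level: "t powr (q / p) < b \<longleftrightarrow> t < b powr (p / q)" if "0 < t" "0 \<le> b" for t b :: real
    proof
      assume "t powr (q / p) < b"
      then have "(t powr (q / p)) powr (p / q) < b powr (p / q)"
        using p(1) q(1) by (intro powr_less_mono2) auto
      then show "t < b powr (p / q)" using that p(1) q(1) by (simp add: powr_powr)
    next
      assume "t < b powr (p / q)"
      then have "t powr (q / p) < (b powr (p / q)) powr (q / p)"
        using p(1) q(1) that by (intro powr_less_mono2) auto
      then show "t powr (q / p) < b" using that p(1) q(1) by (simp add: powr_powr)
    qed
    have "(\<integral>\<^sup>+x. L x * indicator Y x \<partial>M) = (\<integral>\<^sup>+x. \<integral>\<^sup>+t. ennreal (q * t powr (q - 1)) *
        indicator {t. 0 < t \<and> ennreal (c * t) < T x} t * indicator Y x \<partial>lborel \<partial>M)"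
      unfolding L_def by (intro nn_integral_cong nn_integral_multc[symmetric]) measurable
    also have "\<dots> = (\<integral>\<^sup>+t. \<integral>\<^sup>+x. ennreal (q * t powr (q - 1)) *
        indicator {t. 0 < t \<and> ennreal (c * t) < T x} t * indicator Y x \<partial>M \<partial>lborel)"
      by (rule P.Fubini'[symmetric]) measurable
    also have "\<dots> \<le> (\<integral>\<^sup>+t. \<integral>\<^sup>+y. ennreal (g y) * ennreal D *
        (ennreal (a * t powr (a - 1)) * indicator {0<..<g y powr (p / q)} t) \<partial>M \<partial>lborel)"
    proof (rule nn_integral_mono)
      fix t :: real
      show "(\<integral>\<^sup>+x. ennreal (q * t powr (q - 1)) *
          indicator {t. 0 < t \<and> ennreal (c * t) < T x} t * indicator Y x \<partial>M) \<le>
        (\<integral>\<^sup>+y. ennreal (g y) * ennreal D *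
        (ennreal (a * t powr (a - 1)) * indicator {0<..<g y powr (p / q)} t) \<partial>M)"
      proof (cases "0 < t")
        case True
        have "(\<integral>\<^sup>+x. ennreal (q * t powr (q - 1)) *
            indicator {t. 0 < t \<and> ennreal (c * t) < T x} t * indicator Y x \<partial>M) =
          (\<integral>\<^sup>+x. ennreal (q * t powr (q - 1)) * indicator {x \<in> Y. ennreal (c * t) < T x} x \<partial>M)"
          using True by (intro nn_integral_cong) (auto split: split_indicator)
        also have "\<dots> = ennreal (q * t powr (q - 1)) * emeasure M {x \<in> Y. ennreal (c * t) < T x}"
          by (rule nn_integral_cmult_indicator) measurable
        also have "\<dots> \<le> ennreal (q * t powr (q - 1)) * (ennreal (C * t powr (- q / p)) *
            (\<integral>\<^sup>+y. ennreal (g y) * indicator {y. t powr (q / p) < g y} y \<partial>M))"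
          unfolding T_def using dist[OF True gm g] by (rule mult_left_mono) simp
        also have "\<dots> = ennreal (D * (a * t powr (a - 1))) *
            (\<integral>\<^sup>+y. ennreal (g y) * indicator {y. t powr (q / p) < g y} y \<partial>M)"
        proof -
          have "t powr (q - 1) * t powr (- q / p) = t powr (a - 1)"
            by (simp add: a_def algebra_simps flip: powr_add)
          then have "q * t powr (q - 1) * (C * t powr (- q / p)) = D * (a * t powr (a - 1))"
            using a by (simp add: D_def mult_ac)
          then have "ennreal (q * t powr (q - 1)) * ennreal (C * t powr (- q / p)) =
              ennreal (D * (a * t powr (a - 1)))"
            using q(1) ennreal_mult'[of "q * t powr (q - 1)" "C * t powr (- q / p)"] by simp
          then show ?thesis by (simp only: mult.assoc[symmetric])
        qed
        also have "\<dots> = (\<integral>\<^sup>+y. ennreal (D * (a * t powr (a - 1))) *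
            (ennreal (g y) * indicator {y. t powr (q / p) < g y} y) \<partial>M)"
        proof (rule nn_integral_cmult[symmetric])
          show "(\<lambda>y. ennreal (g y) * indicator {y. t powr (q / p) < g y} y) \<in> borel_measurable M"
            by measurable
        qed
        also have "\<dots> = (\<integral>\<^sup>+y. ennreal (g y) * ennreal D *
            (ennreal (a * t powr (a - 1)) * indicator {0<..<g y powr (p / q)} t) \<partial>M)"
          using level[OF True] g(1) D a True
          by (intro nn_integral_cong) (auto simp: ennreal_mult mult_ac split: split_indicator)
        finally show ?thesis .
      qed simp
    qed
    also have "\<dots> = (\<integral>\<^sup>+y. \<integral>\<^sup>+t. ennreal (g y) * ennreal D *
        (ennreal (a * t powr (a - 1)) * indicator {0<..<g y powr (p / q)} t) \<partial>lborel \<partial>M)"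
    proof (rule P.Fubini')
      have "(\<lambda>(y, t). ennreal (g y) * ennreal D *
          (ennreal (a * t powr (a - 1)) * (if 0 < t \<and> t < g y powr (p / q) then 1 else 0)))
          \<in> borel_measurable (M \<Otimes>\<^sub>M lborel)" by measurable
      then show "(\<lambda>(y, t). ennreal (g y) * ennreal D *
          (ennreal (a * t powr (a - 1)) * indicator {0<..<g y powr (p / q)} t))
          \<in> borel_measurable (M \<Otimes>\<^sub>M lborel)"
        by (simp add: indicator_def)
    qed
    also have "\<dots> = (\<integral>\<^sup>+y. ennreal D * ennreal (g y powr p) \<partial>M)"
    proof (rule nn_integral_cong)
      fix y
      have "(\<integral>\<^sup>+t. ennreal (g y) * ennreal D *
          (ennreal (a * t powr (a - 1)) * indicator {0<..<g y powr (p / q)} t) \<partial>lborel) =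
          ennreal (g y) * ennreal D * ennreal ((g y powr (p / q)) powr a)"
        using nn_integral_powr_from_0[OF a, of "g y powr (p / q)"]
        by (subst nn_integral_cmult) auto
      also have "(p / q) * a = p - 1" using p(1) q(1) by (simp add: a_def field_simps)
      then have "(g y powr (p / q)) powr a = g y powr (p - 1)" by (simp only: powr_powr)
      also have "ennreal (g y) * ennreal D * ennreal (g y powr (p - 1)) =
          ennreal D * ennreal (g y * g y powr (p - 1))"
        using g(1) by (simp add: ennreal_mult mult_ac)
      also have "g y * g y powr (p - 1) = g y powr p" using g(1) by (simp add: powr_mult_base)
      finally show "(\<integral>\<^sup>+t. ennreal (g y) * ennreal D *
          (ennreal (a * t powr (a - 1)) * indicator {0<..<g y powr (p / q)} t) \<partial>lborel) =
          ennreal D * ennreal (g y powr p)" .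
    qed
    also have "\<dots> = ennreal D * (\<integral>\<^sup>+y. ennreal (g y powr p) \<partial>M)"
      by (rule nn_integral_cmult) measurable
    also have "\<dots> \<le> ennreal D * 1" using g(2) by (rule mult_left_mono) simp
    finally have LY: "(\<integral>\<^sup>+x. L x * indicator Y x \<partial>M) \<le> ennreal D" by simp
    then have "(\<integral>\<^sup>+x. L x * indicator Y x \<partial>M) \<noteq> \<infinity>" by (auto simp: top_unique)
    then have "AE x in M. L x * indicator Y x \<noteq> \<infinity>"
      by (intro nn_integral_noteq_infinite) auto
    then show "AE x in M. x \<in> Y \<longrightarrow>
        (\<integral>\<^sup>+y. ennreal (d x y powr - (n - \<alpha>)) * ennreal (g y) \<partial>M) < \<infinity>"
      unfolding T_def[symmetric] by eventually_elim (auto simp: L less_top split: if_splits)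
    have "(\<integral>\<^sup>+x. ennreal (enn2real (T x) powr q) * indicator Y x \<partial>M) \<le>
        (\<integral>\<^sup>+x. ennreal (c powr q) * (L x * indicator Y x) \<partial>M)"
    proof (rule nn_integral_mono)
      fix x
      have "ennreal (enn2real (T x) powr q) \<le> ennreal (c powr q) * L x"
        using c q(1) by (auto simp: L powr_divide simp flip: ennreal_mult')
      then show "ennreal (enn2real (T x) powr q) * indicator Y x \<le>
          ennreal (c powr q) * (L x * indicator Y x)"
        by (auto split: split_indicator)
    qed
    also have "\<dots> = ennreal (c powr q) * (\<integral>\<^sup>+x. L x * indicator Y x \<partial>M)"
      by (rule nn_integral_cmult) measurable
    also have "\<dots> \<le> ennreal (c powr q) * ennreal D" using LY by (rule mult_left_mono) simp
    also have "\<dots> \<le> ennreal (max 1 (c powr q * D))"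
      using D by (simp add: ennreal_leI flip: ennreal_mult')
    finally show "(\<integral>\<^sup>+x. ennreal (enn2real (\<integral>\<^sup>+y. ennreal (d x y powr - (n - \<alpha>)) * ennreal (g y) \<partial>M)
        powr q) * indicator Y x \<partial>M) \<le> ennreal (max 1 (c powr q * D))"
      unfolding T_def .
  qed simp
qed

end

section \<open>Two pieces and the variable exponent norm\<close>

lemma frac_kernel_eq: "frac_kernel d \<alpha> n x y = d x y powr - (n x - \<alpha>)"
  by (simp add: frac_kernel_def powr_diff)

context quasi_metric_measure
begin

text \<open>By homogeneity it is enough to bound the modular of \<open>F / (C * N)\<close> by \<open>1\<close>, where \<open>F\<close> is the
  fractional integral and \<open>N\<close> the norm of \<open>f\<close>; on each piece the exponent is constant and \<open>potential_strong_type\<close> applies to \<open>\<bar>f\<bar> / N\<close>. A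
  constant \<open>C \<ge> 1\<close> comes out of the modular at least with the power \<open>1\<close>, because \<open>q x \<ge> 1\<close>, so the sum
  of the two constants serves.\<close>
lemma frac_integral_bounded:
  assumes Y1: "upper_regular_piece X d K M Y1 n1 A" and Y2: "upper_regular_piece X d K M Y2 n2 A"
    and X: "X = Y1 \<union> Y2" and disj: "Y1 \<inter> Y2 = {}"
    and n: "\<And>x. x \<in> Y1 \<Longrightarrow> n x = n1" "\<And>x. x \<in> Y2 \<Longrightarrow> n x = n2"
    and q: "\<And>x. x \<in> Y1 \<Longrightarrow> q x = q1" "\<And>x. x \<in> Y2 \<Longrightarrow> q x = q2"
    and \<alpha>: "0 < \<alpha>" and p: "1 < p" "\<alpha> * p < n1" "\<alpha> * p < n2"
    and q1: "1 \<le> q1" "1 / q1 = 1 / p - \<alpha> / n1" and q2: "1 \<le> q2" "1 / q2 = 1 / p - \<alpha> / n2"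
  shows "\<exists>C. \<forall>f \<in> Lp_space M p.
           (AE x in M. integrable M (\<lambda>y. frac_kernel d \<alpha> n x y * f y)) \<and>
           frac_integral M d \<alpha> n f \<in> var_Lebesgue M q \<and>
           var_norm M q (frac_integral M d \<alpha> n f) \<le> C * Lp_norm M p f"
proof -
  interpret P1: upper_regular_piece X d K M Y1 n1 A by (rule Y1)
  interpret P2: upper_regular_piece X d K M Y2 n2 A by (rule Y2)
  have "\<alpha> * 1 < \<alpha> * p" using \<alpha> p(1) by (intro mult_strict_left_mono)
  then have \<alpha>n: "0 < n1 - \<alpha>" "0 < n2 - \<alpha>" using p by linarith+
  obtain C1 where C1: "C1 \<ge> 1" "\<And>g. g \<in> borel_measurable M \<Longrightarrow> (\<forall>y. 0 \<le> g y) \<Longrightarrow>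
    (\<integral>\<^sup>+y. ennreal (g y powr p) \<partial>M) \<le> 1 \<Longrightarrow>
    (AE x in M. x \<in> Y1 \<longrightarrow> (\<integral>\<^sup>+y. ennreal (d x y powr - (n1 - \<alpha>)) * ennreal (g y) \<partial>M) < \<infinity>) \<and>
    (\<integral>\<^sup>+x. ennreal (enn2real (\<integral>\<^sup>+y. ennreal (d x y powr - (n1 - \<alpha>)) * ennreal (g y) \<partial>M) powr q1) *
      indicator Y1 x \<partial>M) \<le> ennreal C1"
    using P1.potential_strong_type[OF \<alpha> p(1,2) _ q1(2)] q1(1) by auto
  obtain C2 where C2: "C2 \<ge> 1" "\<And>g. g \<in> borel_measurable M \<Longrightarrow> (\<forall>y. 0 \<le> g y) \<Longrightarrow>
    (\<integral>\<^sup>+y. ennreal (g y powr p) \<partial>M) \<le> 1 \<Longrightarrow>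
    (AE x in M. x \<in> Y2 \<longrightarrow> (\<integral>\<^sup>+y. ennreal (d x y powr - (n2 - \<alpha>)) * ennreal (g y) \<partial>M) < \<infinity>) \<and>
    (\<integral>\<^sup>+x. ennreal (enn2real (\<integral>\<^sup>+y. ennreal (d x y powr - (n2 - \<alpha>)) * ennreal (g y) \<partial>M) powr q2) *
      indicator Y2 x \<partial>M) \<le> ennreal C2"
    using P2.potential_strong_type[OF \<alpha> p(1,3) _ q2(2)] q2(1) by auto
  define C where "C = C1 + C2"
  have C: "1 \<le> C" using C1(1) C2(1) by (simp add: C_def)
  note [measurable] = P1.Y P2.Y
  show ?thesis
  proof (intro exI[of _ C] ballI)
    fix f assume "f \<in> Lp_space M p"
    then have fm [measurable]: "f \<in> borel_measurable M"
      and fin: "(\<integral>\<^sup>+x. ennreal (\<bar>f x\<bar> powr p) \<partial>M) < \<infinity>" by (auto simp: Lp_space_def)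
    define F where "F = frac_integral M d \<alpha> n f"
    define N where "N = Lp_norm M p f"
    have kernel: "frac_kernel d \<alpha> n x y = d x y powr - (n x - \<alpha>)" for x y
      by (rule frac_kernel_eq)
    have [measurable]: "(\<lambda>y. frac_kernel d \<alpha> n x y) \<in> borel_measurable M" if "x \<in> X" for x
      unfolding kernel using dist_measurable[OF that] by measurable
    have Fm [measurable]: "F \<in> borel_measurable M"
    proof -
      have [measurable]: "(\<lambda>x. \<integral>y. d x y powr - (n1 - \<alpha>) * f y \<partial>M) \<in> borel_measurable M"
        "(\<lambda>x. \<integral>y. d x y powr - (n2 - \<alpha>) * f y \<partial>M) \<in> borel_measurable M"
        by (intro frac_integral_measurable \<alpha>n fm)+
      have "F x = (if x \<in> Y2 then \<integral>y. d x y powr - (n2 - \<alpha>) * f y \<partial>M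
          else \<integral>y. d x y powr - (n1 - \<alpha>) * f y \<partial>M)" if "x \<in> X" for x
        using that X n by (auto simp: F_def frac_integral_def kernel)
      then show ?thesis by (subst measurable_cong) auto
    qed
    define I where "I = (\<integral>x. \<bar>f x\<bar> powr p \<partial>M)"
    have I: "0 \<le> I" "(\<integral>\<^sup>+x. ennreal (\<bar>f x\<bar> powr p) \<partial>M) = ennreal I"
    proof -
      have "integrable M (\<lambda>x. \<bar>f x\<bar> powr p)" using fin by (simp add: integrable_iff_bounded)
      then show "(\<integral>\<^sup>+x. ennreal (\<bar>f x\<bar> powr p) \<partial>M) = ennreal I"
        unfolding I_def by (intro nn_integral_eq_integral) auto
      show "0 \<le> I" by (simp add: I_def)
    qed
    have NI: "N = I powr (1 / p)" by (simp add: N_def Lp_norm_def I_def)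
    have bdd: "bdd_below {t. 0 < t \<and> modular M q (\<lambda>x. F x / t) \<le> 1}"
      by (rule bdd_belowI[of _ 0]) auto
    have goal: "(AE x in M. integrable M (\<lambda>y. frac_kernel d \<alpha> n x y * f y)) \<and>
        modular M q F < \<infinity> \<and> var_norm M q F \<le> C * N"
    proof (cases "I = 0")
      case True
      then have "AE y in M. f y = 0"
        using I(2) p(1) by (simp add: nn_integral_0_iff_AE)
      then have ae: "AE y in M. frac_kernel d \<alpha> n x y * f y = 0" for x by eventually_elim simp
      have int: "integrable M (\<lambda>y. frac_kernel d \<alpha> n x y * f y)" if "x \<in> X" for x
        by (subst integrable_cong_AE[OF _ _ ae]) (use that in auto)
      have F0: "F x = 0" if "x \<in> X" for x
        unfolding F_def frac_integral_def using integral_cong_AE[OF _ _ ae[of x]] that by simp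
      have m0: "modular M q (\<lambda>x. F x / t) = 0" for t
      proof -
        have "modular M q (\<lambda>x. F x / t) = (\<integral>\<^sup>+x. 0 \<partial>M)"
          unfolding modular_def by (rule nn_integral_cong) (simp add: F0)
        then show ?thesis by simp
      qed
      have "var_norm M q F \<le> 0"
      proof (rule field_le_epsilon)
        fix e :: real assume "0 < e"
        then show "var_norm M q F \<le> 0 + e"
          unfolding var_norm_def by (intro cInf_lower bdd) (simp add: m0)
      qed
      moreover have "AE x in M. integrable M (\<lambda>y. frac_kernel d \<alpha> n x y * f y)"
        by (rule AE_I2) (use int in auto)
      moreover have "modular M q F < \<infinity>" using m0[of 1] by simp
      ultimately show ?thesis using True NI by simp
    next
      case False
      then have N: "0 < N" "N powr p = I" using I(1) p(1) by (auto simp: NI powr_powr)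
      define g where "g y = \<bar>f y\<bar> / N" for y
      have gm [measurable]: "g \<in> borel_measurable M" unfolding g_def by measurable
      have g: "\<forall>y. 0 \<le> g y" using N by (simp add: g_def)
      have gp: "(\<integral>\<^sup>+y. ennreal (g y powr p) \<partial>M) \<le> 1"
      proof -
        have "(\<integral>\<^sup>+y. ennreal (g y powr p) \<partial>M) = (\<integral>\<^sup>+y. ennreal (1 / I) * ennreal (\<bar>f y\<bar> powr p) \<partial>M)"
          using N I(1) by (intro nn_integral_cong) (simp add: g_def powr_divide flip: ennreal_mult')
        also have "\<dots> = ennreal (1 / I) * ennreal I" by (subst nn_integral_cmult) (auto simp: I)
        also have "\<dots> = 1" using I(1) False by (simp flip: ennreal_mult')
        finally show ?thesis by simp
      qed
      define T where "T b x = (\<integral>\<^sup>+y. ennreal (d x y powr - (b - \<alpha>)) * ennreal (g y) \<partial>M)" for b x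
      have [measurable]: "T n1 \<in> borel_measurable M" "T n2 \<in> borel_measurable M"
        unfolding T_def using \<alpha>n by (intro potential_measurable; simp)+
      have S1: "AE x in M. x \<in> Y1 \<longrightarrow> T n1 x < \<infinity>"
        "(\<integral>\<^sup>+x. ennreal (enn2real (T n1 x) powr q1) * indicator Y1 x \<partial>M) \<le> ennreal C1"
        using C1(2)[OF gm g gp] unfolding T_def by auto
      have S2: "AE x in M. x \<in> Y2 \<longrightarrow> T n2 x < \<infinity>"
        "(\<integral>\<^sup>+x. ennreal (enn2real (T n2 x) powr q2) * indicator Y2 x \<partial>M) \<le> ennreal C2"
        using C2(2)[OF gm g gp] unfolding T_def by auto
      have ae: "AE x in M. T (n x) x < \<infinity>"
        using S1(1) S2(1) AE_space by eventually_elim (use X n in auto)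
      have abs_eq: "(\<integral>\<^sup>+y. ennreal \<bar>frac_kernel d \<alpha> n x y * f y\<bar> \<partial>M) = ennreal N * T (n x) x"
        if "x \<in> X" for x
      proof -
        note [measurable] = dist_measurable[OF that]
        have "ennreal \<bar>frac_kernel d \<alpha> n x y * f y\<bar> =
            ennreal N * (ennreal (d x y powr - (n x - \<alpha>)) * ennreal (g y))" for y
          using N by (simp add: kernel g_def abs_mult flip: ennreal_mult')
        then show ?thesis unfolding T_def by (simp add: nn_integral_cmult)
      qed
      have int: "integrable M (\<lambda>y. frac_kernel d \<alpha> n x y * f y)" "\<bar>F x\<bar> \<le> N * enn2real (T (n x) x)"
        if x: "x \<in> X" and T: "T (n x) x < \<infinity>" for x
      proof -
        show i: "integrable M (\<lambda>y. frac_kernel d \<alpha> n x y * f y)"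
          using x T abs_eq[OF x] by (simp add: integrable_iff_bounded ennreal_mult_less_top)
        have "\<bar>F x\<bar> \<le> (\<integral>y. \<bar>frac_kernel d \<alpha> n x y * f y\<bar> \<partial>M)"
          unfolding F_def frac_integral_def by (rule integral_abs_bound)
        also have "\<dots> = enn2real (\<integral>\<^sup>+y. ennreal \<bar>frac_kernel d \<alpha> n x y * f y\<bar> \<partial>M)"
          using x by (intro integral_eq_nn_integral) auto
        also have "\<dots> = N * enn2real (T (n x) x)"
          using N by (simp add: abs_eq[OF x] enn2real_mult)
        finally show "\<bar>F x\<bar> \<le> N * enn2real (T (n x) x)" .
      qed
      have mod1: "modular M q (\<lambda>x. F x / (C * N)) \<le> 1"
      proof -
        have "modular M q (\<lambda>x. F x / (C * N)) \<le>
            (\<integral>\<^sup>+x. ennreal (1 / C) * (ennreal (enn2real (T n1 x) powr q1) * indicator Y1 x +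
              ennreal (enn2real (T n2 x) powr q2) * indicator Y2 x) \<partial>M)"
          unfolding modular_def
        proof (rule nn_integral_mono_AE)
          show "AE x in M. ennreal (\<bar>F x / (C * N)\<bar> powr q x) \<le>
            ennreal (1 / C) * (ennreal (enn2real (T n1 x) powr q1) * indicator Y1 x +
              ennreal (enn2real (T n2 x) powr q2) * indicator Y2 x)"
            using ae AE_space
          proof eventually_elim
            case (elim x)
            then have x: "x \<in> X" by simp
            have qx: "1 \<le> q x" using x X q q1 q2 by auto
            have "\<bar>F x / (C * N)\<bar> \<le> enn2real (T (n x) x) / C"
              using int(2)[OF x elim(1)] C N by (simp add: abs_divide abs_mult field_simps)
            then have "\<bar>F x / (C * N)\<bar> powr q x \<le> (enn2real (T (n x) x) / C) powr q x"
              using qx by (intro powr_mono2) auto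
            also have "\<dots> = enn2real (T (n x) x) powr q x / C powr q x"
              using C by (simp add: powr_divide)
            also have "\<dots> \<le> enn2real (T (n x) x) powr q x / C"
              using C qx powr_mono[of 1 "q x" C] by (intro divide_left_mono) auto
            finally have "ennreal (\<bar>F x / (C * N)\<bar> powr q x) \<le>
                ennreal (1 / C) * ennreal (enn2real (T (n x) x) powr q x)"
              using C by (simp add: ennreal_leI flip: ennreal_mult')
            then show ?case using x X n q disj by (auto split: split_indicator)
          qed
        qed
        also have "\<dots> = ennreal (1 / C) *
            ((\<integral>\<^sup>+x. ennreal (enn2real (T n1 x) powr q1) * indicator Y1 x \<partial>M) +
             (\<integral>\<^sup>+x. ennreal (enn2real (T n2 x) powr q2) * indicator Y2 x \<partial>M))"
          by (subst nn_integral_cmult, measurable, subst nn_integral_add, measurable)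
        also have "\<dots> \<le> ennreal (1 / C) * (ennreal C1 + ennreal C2)"
          using S1(2) S2(2) by (intro mult_left_mono add_mono) auto
        also have "\<dots> = ennreal (1 / C) * ennreal C" using C1(1) C2(1) by (simp add: C_def)
        also have "\<dots> = 1" using C by (simp flip: ennreal_mult')
        finally show ?thesis .
      qed
      have CN: "0 < C * N" using C N by simp
      \<comment> \<open>Undoing the scaling costs a bounded factor, since \<open>q\<close> takes two values only.\<close>
      define B where "B = max ((C * N) powr q1) ((C * N) powr q2)"
      have "modular M q F \<le> (\<integral>\<^sup>+x. ennreal B * ennreal (\<bar>F x / (C * N)\<bar> powr q x) \<partial>M)"
        unfolding modular_def
      proof (rule nn_integral_mono)
        fix x assume "x \<in> space M"
        then have B: "(C * N) powr q x \<le> B" using X q by (auto simp: B_def)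
        have "\<bar>F x\<bar> powr q x = (C * N) powr q x * \<bar>F x / (C * N)\<bar> powr q x"
          using CN less_imp_neq[OF CN] by (simp add: abs_divide powr_divide)
        also have "\<dots> \<le> B * \<bar>F x / (C * N)\<bar> powr q x" using B by (rule mult_right_mono) simp
        finally show "ennreal (\<bar>F x\<bar> powr q x) \<le> ennreal B * ennreal (\<bar>F x / (C * N)\<bar> powr q x)"
          by (simp add: ennreal_leI B_def flip: ennreal_mult'')
      qed
      also have "\<dots> = ennreal B * modular M q (\<lambda>x. F x / (C * N))"
        unfolding modular_def
      proof (rule nn_integral_cmult)
        have "(\<lambda>x. ennreal (\<bar>F x / (C * N)\<bar> powr (if x \<in> Y1 then q1 else q2))) \<in> borel_measurable M"
          by measurable
        then show "(\<lambda>x. ennreal (\<bar>F x / (C * N)\<bar> powr q x)) \<in> borel_measurable M"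
          by (rule measurable_cong[THEN iffD1, rotated]) (use X q in auto)
      qed
      also have "\<dots> \<le> ennreal B * 1" using mod1 by (rule mult_left_mono) simp
      finally have "modular M q F < \<infinity>" by (simp add: le_less_trans)
      moreover have "var_norm M q F \<le> C * N"
        unfolding var_norm_def by (intro cInf_lower bdd) (use mod1 CN in simp)
      moreover have "AE x in M. integrable M (\<lambda>y. frac_kernel d \<alpha> n x y * f y)"
        using ae AE_space by eventually_elim (use int in auto)
      ultimately show ?thesis by blast
    qed
    then show "(AE x in M. integrable M (\<lambda>y. frac_kernel d \<alpha> n x y * f y)) \<and>
        frac_integral M d \<alpha> n f \<in> var_Lebesgue M q \<and>
        var_norm M q (frac_integral M d \<alpha> n f) \<le> C * Lp_norm M p f"
      using Fm unfolding F_def N_def var_Lebesgue_def by blast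
  qed
qed

end

section \<open>Positivity of balls and the glued measure\<close>

text \<open>The lower Ahlfors bound holds for radii up to the diameter of \<open>Y\<close>, so it has to be known that
  the diameter is positive: \<open>x0\<close> is an accumulation point of \<open>Y\<close>, hence \<open>Y\<close> has at least two points. The
  weight vanishes at \<open>x0\<close> alone, which does not belong to \<open>Y\<close>.\<close>
lemma ahlfors_weighted_ball_pos:
  assumes qm: "quasi_metric_on X d" and balls: "balls_open X d" and x0: "x0 \<in> X" "x0 \<notin> Y"
    and Y: "Y \<subseteq> X" and cl: "x0 \<in> qtopology X d closure_of Y"
    and sets: "sets \<nu> = sets (qborel Y d)" and reg: "ahlfors_regular Y d \<nu> Q"
    and z: "z \<in> Y" and r: "0 < r"
  shows "0 < (\<integral>\<^sup>+x\<in>qball X d z r \<inter> Y. ennreal (d x x0 powr \<gamma>) \<partial>\<nu>)"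
proof -
  have dist: "0 \<le> d x y" "d x y = 0 \<longleftrightarrow> x = y" "d x y = d y x" if "x \<in> X" "y \<in> X" for x y
    using qm that unfolding quasi_metric_on_def by blast+
  have meet: "\<exists>y\<in>Y. y \<in> U" if "openin (qtopology X d) U" "x0 \<in> U" for U
    using cl that by (auto simp: in_closure_of)
  obtain a where a: "a \<in> Y"
    using meet[of X] x0 openin_topspace[of "qtopology X d"] by (auto simp: topspace_qtopology)
  have da: "0 < d a x0" using dist[of a x0] a Y x0 by (metis less_eq_real_def subsetD)
  obtain b where b: "b \<in> Y" "d b x0 < d a x0"
    using meet[of "qball X d x0 (d a x0)"] balls x0 da dist(2)[OF x0(1) x0(1)]
    by (auto simp: balls_open_def qball_def)
  define t where "t = min r (d a b)"
  have "0 < d a b" using dist[of a b] a b Y by (metis less_eq_real_def less_irrefl subsetD)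
  then have t: "0 < t" "t \<le> r" using r by (auto simp: t_def)
  have "ennreal t \<le> ennreal (d a b)" by (simp add: t_def ennreal_leI)
  also have "\<dots> \<le> qdiam Y d"
    unfolding qdiam_def using a b(1) by (intro SUP_upper2[of a] SUP_upper) auto
  finally have "\<exists>A\<ge>1. ennreal (inverse A * t powr Q) \<le> emeasure \<nu> (qball Y d z t)"
    using reg z t unfolding ahlfors_regular_def by blast
  then obtain A where A: "A \<ge> 1" "ennreal (inverse A * t powr Q) \<le> emeasure \<nu> (qball Y d z t)" by blast
  have B: "qball X d z r \<inter> Y \<in> sets \<nu>"
    unfolding sets using balls z Y r
    by (intro Int_sets_qborel) (auto simp: balls_open_def sets_qborel)
  have "0 < ennreal (inverse A * t powr Q)" using A(1) t by (simp add: ennreal_less_zero_iff)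
  also note A(2)
  also have "emeasure \<nu> (qball Y d z t) \<le> emeasure \<nu> (qball X d z r \<inter> Y)"
    using t Y B by (intro emeasure_mono) (auto simp: qball_def)
  finally have pos: "0 < emeasure \<nu> (qball X d z r \<inter> Y)" .
  have [measurable]: "(\<lambda>x. d x x0) \<in> borel_measurable \<nu>"
    unfolding measurable_cong_sets[OF sets refl]
    by (rule borel_measurable_quasi_metric[OF balls x0(1) Y]) (use dist x0 in auto)
  show ?thesis
  proof (rule ccontr)
    assume "\<not> ?thesis"
    then have "(\<integral>\<^sup>+x\<in>qball X d z r \<inter> Y. ennreal (d x x0 powr \<gamma>) \<partial>\<nu>) = 0" by simp
    then have "AE x in \<nu>. ennreal (d x x0 powr \<gamma>) * indicator (qball X d z r \<inter> Y) x = 0"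
      using B by (subst (asm) nn_integral_0_iff_AE) auto
    then have "AE x in \<nu>. x \<notin> qball X d z r \<inter> Y"
    proof eventually_elim
      case (elim x)
      have "d x x0 \<noteq> 0" if "x \<in> Y" using that dist(2)[of x x0] x0 Y by auto
      with elim show ?case by (auto split: split_indicator_asm)
    qed
    then have "emeasure \<nu> (qball X d z r \<inter> Y) = 0"
      using AE_iff_null_sets[OF B] by blast
    with pos show False by simp
  qed
qed

theorem theorem6p1:
  fixes X X1 X2 :: "'a set" and d :: "'a \<Rightarrow> 'a \<Rightarrow> real" and x0 :: 'a
    and \<mu>1 \<mu>2 \<mu> :: "'a measure"
    and n1 n2 \<gamma>1 \<gamma>2 \<alpha> p :: real
    and n q :: "'a \<Rightarrow> real"
  assumes "quasi_metric_on X d"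
    and "qdiam X d < \<infinity>"
    and "balls_open X d"
    and "X = X1 \<union> X2 \<union> {x0}"
    and "X1 \<inter> X2 = {}" and "x0 \<notin> X1" and "x0 \<notin> X2"
    and "contact_order_zero X d X1 X2 x0"
    and "sets \<mu>1 = sets (qborel X1 d)" and "sets \<mu>2 = sets (qborel X2 d)"
    and "ahlfors_regular X1 d \<mu>1 n1" and "ahlfors_regular X2 d \<mu>2 n2"
    and "0 < n1" and "n1 \<le> n2"
    and "\<gamma>1 > - n1" and "\<gamma>2 > - n2" and "\<gamma>1 - \<gamma>2 = n2 - n1"
    and "\<gamma>1 > 0" and "\<gamma>2 > 0"
    and "\<mu> = glued_measure X d x0 X1 \<mu>1 \<gamma>1 X2 \<mu>2 \<gamma>2"
    and "\<forall>x\<in>X1. n x = n1" and "\<forall>x\<in>X2. n x = n2" and "n x0 = n1"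
    and "\<exists>K4. \<forall>x\<in>X. \<forall>r>0. emeasure \<mu> (qball X d x r) \<le> ennreal (K4 * r powr n x)"
    and "0 < \<alpha>" and "\<alpha> < n1"
    and "1 < p"
    and "\<forall>x\<in>X. 1 < q x"
    and "ereal p < (INF x\<in>X. ereal (q x))"
    and "(SUP x\<in>X. ereal (q x)) < \<infinity>"
    and "\<forall>x\<in>X. 1 / q x = 1 / p - \<alpha> / n x"
  shows "\<exists>C. \<forall>f \<in> Lp_space \<mu> p.
           (AE x in \<mu>. integrable \<mu> (\<lambda>y. frac_kernel d \<alpha> n x y * f y)) \<and>
           frac_integral \<mu> d \<alpha> n f \<in> var_Lebesgue \<mu> q \<and>
           var_norm \<mu> q (frac_integral \<mu> d \<alpha> n f) \<le> C * Lp_norm \<mu> p f"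
proof -
  note qm = assms(1) and balls = assms(3) and X = assms(4) and \<mu> = assms(20)
  have x0: "x0 \<in> X" and sub: "X1 \<subseteq> X" "X2 \<subseteq> X" using X by blast+
  have dist: "0 \<le> d x y" "d x y = 0 \<longleftrightarrow> x = y" "d x y = d y x" if "x \<in> X" "y \<in> X" for x y
    using qm that unfolding quasi_metric_on_def by blast+
  obtain K where "K > 0 \<and> (\<forall>x\<in>X. \<forall>y\<in>X. \<forall>z\<in>X. d x y \<le> K * (d x z + d z y))"
    using conjunct2[OF qm[unfolded quasi_metric_on_def]] by (elim exE)
  then have K: "K > 0" "\<And>x y z. x \<in> X \<Longrightarrow> y \<in> X \<Longrightarrow> z \<in> X \<Longrightarrow> d x y \<le> K * (d x z + d z y)"
    by simp_all
  have sets_\<mu>: "sets \<mu> = sets (qborel X d)" by (simp add: \<mu> sets_glued_measure)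
  have em: "emeasure \<mu> E = (\<integral>\<^sup>+x\<in>E \<inter> X1. ennreal (d x x0 powr \<gamma>1) \<partial>\<mu>1) +
      (\<integral>\<^sup>+x\<in>E \<inter> X2. ennreal (d x x0 powr \<gamma>2) \<partial>\<mu>2)" if "E \<in> sets \<mu>" for E
    unfolding \<mu> using that
    by (intro emeasure_glued_measure qm balls x0 sub assms(9,10)) (simp add: sets_\<mu>)
  obtain K4 where K4: "\<And>x r. x \<in> X \<Longrightarrow> 0 < r \<Longrightarrow> emeasure \<mu> (qball X d x r) \<le> ennreal (K4 * r powr n x)"
    using assms(24) by blast
  define A where "A = max K4 0"
  have growth: "emeasure \<mu> (qball X d x r) \<le> ennreal (A * r powr n x)" if "x \<in> X" "0 < r" for x r
    using K4[OF that] by (rule order_trans) (auto simp: A_def intro!: ennreal_leI mult_right_mono)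
  have finite: "emeasure \<mu> X < \<infinity>"
  proof -
    obtain D where D: "qdiam X d = ennreal D" "0 \<le> D" using assms(2) by (cases "qdiam X d") auto
    have "d x x0 < D + 1" if "x \<in> X" for x
    proof -
      have "ennreal (d x x0) \<le> qdiam X d"
        unfolding qdiam_def using that x0 by (intro SUP_upper2[of x] SUP_upper) auto
      then show ?thesis using D by simp
    qed
    then have "X = qball X d x0 (D + 1)" by (auto simp: qball_def)
    then have "emeasure \<mu> X \<le> ennreal (A * (D + 1) powr n x0)" using growth[OF x0, of "D + 1"] D by simp
    then show ?thesis by (simp add: le_less_trans)
  qed
  interpret quasi_metric_measure X d K \<mu>
    by standard (use K dist balls sets_\<mu> finite in blast)+
  have cl: "x0 \<in> qtopology X d closure_of X1" "x0 \<in> qtopology X d closure_of X2"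
    and cl_Int: "(qtopology X d closure_of X1) \<inter> (qtopology X d closure_of X2) = {x0}"
    using assms(8) unfolding contact_order_zero_def by blast+
  have pos12: "0 < emeasure \<mu> (qball X d x r)" if x: "x \<in> X1 \<union> X2" and r: "0 < r" for x r
  proof -
    have "qball X d x r \<in> sets \<mu>" using x sub by (intro ball_measurable) auto
    note em[OF this]
    moreover have "0 < (\<integral>\<^sup>+x\<in>qball X d x r \<inter> X1. ennreal (d x x0 powr \<gamma>1) \<partial>\<mu>1)" if "x \<in> X1"
      by (rule ahlfors_weighted_ball_pos[OF qm balls x0 assms(6) sub(1) cl(1) assms(9,11) that r])
    moreover have "0 < (\<integral>\<^sup>+x\<in>qball X d x r \<inter> X2. ennreal (d x x0 powr \<gamma>2) \<partial>\<mu>2)" if "x \<in> X2"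
      by (rule ahlfors_weighted_ball_pos[OF qm balls x0 assms(7) sub(2) cl(2) assms(10,12) that r])
    ultimately show ?thesis using x by (auto simp: add_pos_nonneg add_nonneg_pos)
  qed
  have pos: "0 < emeasure \<mu> (qball X d x r)" if x: "x \<in> X" and r: "0 < r" for x r
  proof (cases "x = x0")
    case True
    have "x0 \<in> qball X d x0 r" using x0 r dist(2)[OF x0 x0] by (simp add: qball_def)
    then obtain z where z: "z \<in> X1" "z \<in> qball X d x0 r"
      using cl(1) ball_open[OF x0, of r] unfolding in_closure_of by blast
    then obtain s where s: "s > 0" "qball X d z s \<subseteq> qball X d x0 r"
      using ball_open[OF x0, of r] unfolding openin_qtopology by blast
    have "0 < emeasure \<mu> (qball X d z s)" using z s by (intro pos12) auto
    also have "\<dots> \<le> emeasure \<mu> (qball X d x0 r)" using s x0 by (intro emeasure_mono) auto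
    finally show ?thesis using True by simp
  next
    case False
    then have "x \<in> X1 \<union> X2" using x unfolding X by blast
    then show ?thesis using r by (rule pos12)
  qed
  \<comment> \<open>\<open>X2\<close> is open, as the closure of \<open>X1\<close> adds nothing but \<open>x0\<close>.\<close>
  have X2_eq: "X2 = X - qtopology X d closure_of X1"
  proof -
    let ?cl = "\<lambda>S. qtopology X d closure_of S"
    have sub_cl: "X1 \<subseteq> ?cl X1" "X2 \<subseteq> ?cl X2"
      by (rule closure_of_subset; simp add: topspace_qtopology sub)+
    have "x \<notin> ?cl X1" if "x \<in> X2" for x
    proof
      assume "x \<in> ?cl X1"
      then have "x \<in> ?cl X1 \<inter> ?cl X2" using that sub_cl(2) by blast
      then show False using that assms(7) unfolding cl_Int by blast
    qed
    moreover have "x \<in> X2" if "x \<in> X" "x \<notin> ?cl X1" for x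
      using that sub_cl(1) cl(1) unfolding X by blast
    ultimately show ?thesis using sub(2) by blast
  qed
  have "openin (qtopology X d) X2"
    unfolding X2_eq using closedin_closure_of[of "qtopology X d" X1]
    by (simp add: closedin_def topspace_qtopology)
  then have X2m: "X2 \<in> sets \<mu>" by (rule open_measurable)
  have "X - X2 \<in> sets \<mu>" using sets.compl_sets[OF X2m] by simp
  moreover have "X - X2 = insert x0 X1" using X assms(5,7) by auto
  ultimately have X1m: "insert x0 X1 \<in> sets \<mu>" by simp
  have n: "n x = n1" if "x \<in> insert x0 X1" for x using that assms(21,23) by auto
  have n': "n x = n2" if "x \<in> X2" for x using that assms(22) by auto
  have P1: "upper_regular_piece X d K \<mu> (insert x0 X1) n1 A"
  proof
    show "emeasure \<mu> (qball X d x r) \<le> ennreal (A * r powr n1)" if "x \<in> insert x0 X1" "0 < r" for x r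
      using growth[of x r] n[OF that(1)] that x0 sub by auto
  qed (use X1m assms(13) pos in \<open>auto simp: A_def\<close>)
  have P2: "upper_regular_piece X d K \<mu> X2 n2 A"
  proof
    show "emeasure \<mu> (qball X d x r) \<le> ennreal (A * r powr n2)" if "x \<in> X2" "0 < r" for x r
      using growth[of x r] n'[OF that(1)] that sub by auto
  qed (use X2m assms(13,14) pos in \<open>auto simp: A_def\<close>)
  have "X2 \<noteq> {}" using cl(2) by auto
  then obtain b where b: "b \<in> X2" by blast
  have q_eq: "q x = q y" if "x \<in> X" "y \<in> X" "n x = n y" for x y
  proof -
    have "1 / q x = 1 / q y" using that assms(31) by simp
    then show ?thesis by (metis divide_divide_eq_right div_by_1 mult_1 inverse_inverse_eq inverse_eq_divide)
  qed
  \<comment> \<open>Positivity of \<open>1 / q x\<close> places \<open>p\<close> below the critical exponent \<open>n x / \<alpha>\<close>.\<close>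
  have dim: "\<alpha> * p < n x" if "x \<in> X" for x
  proof -
    have "0 < 1 / q x" using assms(28) that by fastforce
    then have "\<alpha> / n x < 1 / p" using assms(31) that by simp
    moreover have "0 < n x" using that X n n' assms(13,14) by fastforce
    ultimately show ?thesis using assms(27) by (simp add: field_simps)
  qed
  show ?thesis
  proof (rule frac_integral_bounded[OF P1 P2, where ?q1.0 = "q x0" and ?q2.0 = "q b"])
    show "X = insert x0 X1 \<union> X2" "insert x0 X1 \<inter> X2 = {}" using X assms(5,7) by auto
    show "q x = q x0" if "x \<in> insert x0 X1" for x
      using that n sub x0 by (intro q_eq) auto
    show "q x = q b" if "x \<in> X2" for x using that b n' sub by (intro q_eq) auto
    show "\<alpha> * p < n1" "\<alpha> * p < n2" using dim[of x0] dim[of b] n[of x0] n'[of b] x0 b sub by auto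
    show "1 \<le> q x0" "1 \<le> q b" using assms(28) x0 b sub by fastforce+
    show "1 / q x0 = 1 / p - \<alpha> / n1" "1 / q b = 1 / p - \<alpha> / n2"
      using assms(31) n[of x0] n'[of b] x0 b sub by auto
  qed (use n n' assms(25,27) in auto)
qed

end
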